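(* Let $G,F,Q,\omega$ and the quasi-Hopf algebra $A^{\mathrm{op}}$ be as described in the context. The canonical central element $\nu_{A^{\mathrm{op}}}$ is given by the formula $$\nu_{A^{\mathrm{op}}}=|F|^{-1}\sum_{(q\triangleleft x).q=e}\omega(xq,xq,xq)\ \delta_q\,(xq)^2 .$$ One also has $$\nu_{A^{\mathrm{op}}}=|F|^{-1}\sum_{(q\triangleleft x).q=e}\tau_x(q\triangleleft x,q)\,\sigma_q(x,q\triangleright x)\,\omega((q\triangleleft x)^L,q\triangleleft x,q)\,\sigma_q\bigl(x(q\triangleright x),(q\triangleleft x)q\bigr)\ \delta_q\,(xq)^2 .$$ Here both sums run over all pairs $(q,x)\in Q\times F$ with $(q\triangleleft x).q=e$ (for such pairs $(xq)^2\in F$ and $(q\triangleleft x)q\in F$).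
   Context: Setting. $k$ is an algebraically closed field of characteristic zero; $G$ is a finite group with identity $e$; $F\subseteq G$ is a subgroup; $Q\subseteq G$ with $e\in Q$ is simultaneously a set of representatives of the cosets $Fg$ and of the cosets $gF$, so every $g\in G$ factors uniquely as $g=xq$ and uniquely as $g=py$ with $x,y\in F$, $p,q\in Q$. Define $\triangleright:Q\times F\to F$, $\triangleleft:Q\times F\to Q$, $.:Q\times Q\to Q$, $\theta:Q\times Q\to F$ by $qx=(q\triangleright x)(q\triangleleft x)$ and $pq=\theta(p,q)\,(p.q)$ for $p,q\in Q$, $x\in F$. For every $p\in Q$ there are unique $p^L,p^R\in Q$ with $p^L.p=e=p.p^R$. Put $p\succ x=\theta(p,p^R)^{-1}\,(p\triangleright x)\,\theta(p\triangleleft x,(p\triangleleft x)^R)\in F$. $\omega:G\times G\times G\to k^\times$ is a normalized 3-cocycle, i.e. $\omega(ab,c,d)\omega(a,b,cd)=\omega(a,b,c)\omega(a,bc,d)\omega(b,c,d)$ and $\omega(e,a,b)=\omega(a,e,b)=\omega(a,b,e)=1$, satisfying $\omega|_{F\times G\times G}=1$ and $\omega|_{G\times F\times Q}=1$. Put $\sigma_p(x,y)=\omega(p,x,y)$ and $\tau_x(p,q)=\omega(p,q,x)$ for $p,q\in Q$, $x,y\in F$. $A=k^Q\#_\sigma kF$ is the vector space $k^Q\otimes kF$ with basis $\delta_px:=\delta_p\otimes x$ ($p\in Q$, $x\in F$), multiplication $(\delta_px).(\delta_qy)=\delta_{p\triangleleft x,\,q}\,\sigma_p(x,y)\,\delta_p\,xy$,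 unit $\sum_{p\in Q}\delta_pe$, comultiplication $\Delta(\delta_px)=\sum_{s.t=p}\tau_x(s,t)\,\delta_s(t\triangleright x)\otimes\delta_tx$ and counit $\epsilon(\delta_px)=\delta_{p,e}$. $A^{\mathrm{op}}$ is $A$ with the opposite multiplication $a\circ b=b.a$ and the same $\Delta,\epsilon$. It is a semisimple quasi-Hopf algebra with associator $\Phi=\sum_{p,q,r\in Q}\omega(p,q,r)\,\delta_p\theta(q,r)\otimes\delta_qe\otimes\delta_re$, quasi-antipode $\mathcal S(\delta_px)=\tau_{p\succ x}(p,p^R)^{-1}\sigma_{p^R}(p\succ x,(p\succ x)^{-1})^{-1}\,\delta_{(p\triangleleft x)^R}(p\succ x)^{-1}$, $\alpha=1$ and $\beta=\sum_{q\in Q}\omega(q^{-1},q,q^{-1})\,\delta_q\theta(q^L,q)^{-1}$. Canonical central element. For a finite dimensional semisimple quasi-Hopf algebra $(H,\Delta,\epsilon,\Phi,\mathcal S,\alpha,\beta)$ let $\Lambda\in H$ be the unique normalized two-sided integral: $h\Lambda=\epsilon(h)\Lambda=\Lambda h$ for all $h$, $\epsilon(\Lambda)=1$. Write $\Phi=\Phi^{(1)}\otimes\Phi^{(2)}\otimes\Phi^{(3)}$, $\Phi^{-1}=\Phi^{(-1)}\otimes\Phi^{(-2)}\otimes\Phi^{(-3)}$, $q_L=\mathcal S(\Phi^{(-1)})\alpha\Phi^{(-2)}\otimes\Phi^{(-3)}$ and $p_L=\Phi^{(2)}\mathcal S^{-1}(\Phi^{(1)}\beta)\otimes\Phi^{(3)}$.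 Then $\nu_H=m(q_L\Delta(\Lambda)p_L)$, $m:H\otimes H\to H$ being the multiplication. For $H=A^{\mathrm{op}}$ all products are taken with respect to $\circ$. *)

theory Defs
  imports
    "HOL-Algebra.Coset"
    "HOL-Computational_Algebra.Polynomial"
    "HOL-Library.Function_Algebras"
begin

section \<open>Finite dimensional algebras in coordinates\<close>

text \<open>
  A finite dimensional vector space over \<open>'k\<close> is given by a finite set \<open>B\<close> of basis labels;
  its elements are the functions \<open>'b \<Rightarrow> 'k\<close> vanishing outside \<open>B\<close>, and the tensor product
  of the spaces on \<open>B\<close> and \<open>C\<close> is the space on \<open>B \<times> C\<close>. Linear maps are recorded by their
  values on basis labels.
\<close>

definition vecs :: "'b set \<Rightarrow> ('b \<Rightarrow> 'k::field) set" where
  "vecs B = {v. \<forall>b. b \<notin> B \<longrightarrow> v b = 0}"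

definition scale :: "'k \<Rightarrow> ('b \<Rightarrow> 'k::field) \<Rightarrow> ('b \<Rightarrow> 'k)" (infixr \<open>*\<^sub>v\<close> 75) where
  "c *\<^sub>v v = (\<lambda>b. c * v b)"

definition bvec :: "'b \<Rightarrow> ('b \<Rightarrow> 'k::field)" where
  "bvec b = (\<lambda>c. if c = b then 1 else 0)"

definition tens :: "('b \<Rightarrow> 'k::field) \<Rightarrow> ('c \<Rightarrow> 'k) \<Rightarrow> ('b \<times> 'c \<Rightarrow> 'k)" where
  "tens u v = (\<lambda>(b, c). u b * v c)"

definition linext :: "'b set \<Rightarrow> ('b \<Rightarrow> ('c \<Rightarrow> 'k::field)) \<Rightarrow> ('b \<Rightarrow> 'k) \<Rightarrow> ('c \<Rightarrow> 'k)" where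
  "linext B f v = (\<Sum>b\<in>B. v b *\<^sub>v f b)"

text \<open>\<open>mulb H a b\<close> is the product of the basis vectors labelled \<open>a\<close> and \<open>b\<close>.\<close>

record ('b, 'k) alg =
  basis :: "'b set"
  mulb :: "'b \<Rightarrow> 'b \<Rightarrow> ('b \<Rightarrow> 'k)"
  unit :: "'b \<Rightarrow> 'k"

record ('b, 'k) alg_coalg = "('b, 'k) alg" +
  comulb :: "'b \<Rightarrow> ('b \<times> 'b \<Rightarrow> 'k)"
  counitb :: "'b \<Rightarrow> 'k"

text \<open>Triple tensors are indexed by \<open>'b \<times> ('b \<times> 'b)\<close>.\<close>

record ('b, 'k) quasi_hopf = "('b, 'k) alg_coalg" +
  associator :: "'b \<times> 'b \<times> 'b \<Rightarrow> 'k"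
  antipodeb :: "'b \<Rightarrow> ('b \<Rightarrow> 'k)"
  alpha :: "'b \<Rightarrow> 'k"
  beta :: "'b \<Rightarrow> 'k"

definition amult ::
    "('b, 'k::field, 'm) alg_scheme \<Rightarrow> ('b \<Rightarrow> 'k) \<Rightarrow> ('b \<Rightarrow> 'k) \<Rightarrow> ('b \<Rightarrow> 'k)" where
  "amult H u v = (\<Sum>a\<in>basis H. \<Sum>b\<in>basis H. (u a * v b) *\<^sub>v mulb H a b)"

definition tensor_alg ::
    "('b, 'k::field, 'm) alg_scheme \<Rightarrow> ('c, 'k, 'n) alg_scheme \<Rightarrow> ('b \<times> 'c, 'k) alg" where
  "tensor_alg H K =
    \<lparr>basis = basis H \<times> basis K,
     mulb = (\<lambda>(a, b) (a', b'). tens (mulb H a a') (mulb K b b')),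
     unit = tens (unit H) (unit K)\<rparr>"

definition alg_inverse :: "('b, 'k::field, 'm) alg_scheme \<Rightarrow> ('b \<Rightarrow> 'k) \<Rightarrow> ('b \<Rightarrow> 'k)" where
  "alg_inverse H u =
    (THE v. v \<in> vecs (basis H) \<and> amult H u v = unit H \<and> amult H v u = unit H)"

definition comul ::
    "('b, 'k::field, 'm) alg_coalg_scheme \<Rightarrow> ('b \<Rightarrow> 'k) \<Rightarrow> ('b \<times> 'b \<Rightarrow> 'k)" where
  "comul H = linext (basis H) (comulb H)"

definition counit :: "('b, 'k::field, 'm) alg_coalg_scheme \<Rightarrow> ('b \<Rightarrow> 'k) \<Rightarrow> 'k" where
  "counit H v = (\<Sum>b\<in>basis H. v b * counitb H b)"

definition antipode ::
    "('b, 'k::field, 'm) quasi_hopf_scheme \<Rightarrow> ('b \<Rightarrow> 'k) \<Rightarrow> ('b \<Rightarrow> 'k)" where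
  "antipode H = linext (basis H) (antipodeb H)"

definition antipode_inv ::
    "('b, 'k::field, 'm) quasi_hopf_scheme \<Rightarrow> ('b \<Rightarrow> 'k) \<Rightarrow> ('b \<Rightarrow> 'k)" where
  "antipode_inv H = the_inv_into (vecs (basis H)) (antipode H)"


section \<open>The canonical central element\<close>

text \<open>
  The records carry data only. The descriptions below (and \<open>antipode_inv\<close>, \<open>alg_inverse\<close> above)
  denote what they should when the record is a finite dimensional semisimple quasi-Hopf algebra.
\<close>

definition is_normalized_integral ::
    "('b, 'k::field, 'm) alg_coalg_scheme \<Rightarrow> ('b \<Rightarrow> 'k) \<Rightarrow> bool" where
  "is_normalized_integral H L \<longleftrightarrow>
     L \<in> vecs (basis H) \<and>
     (\<forall>h\<in>vecs (basis H). amult H h L = counit H h *\<^sub>v L \<and> amult H L h = counit H h *\<^sub>v L) \<and>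
     counit H L = 1"

definition normalized_integral :: "('b, 'k::field, 'm) alg_coalg_scheme \<Rightarrow> ('b \<Rightarrow> 'k)" where
  "normalized_integral H = (THE L. is_normalized_integral H L)"

definition associator_inv ::
    "('b, 'k::field, 'm) quasi_hopf_scheme \<Rightarrow> ('b \<times> 'b \<times> 'b \<Rightarrow> 'k)" where
  "associator_inv H = alg_inverse (tensor_alg H (tensor_alg H H)) (associator H)"

definition q_L :: "('b, 'k::field, 'm) quasi_hopf_scheme \<Rightarrow> ('b \<times> 'b \<Rightarrow> 'k)" where
  "q_L H =
    linext (basis H \<times> basis H \<times> basis H)
      (\<lambda>(a, b, c).
        tens (amult H (amult H (antipode H (bvec a)) (alpha H)) (bvec b)) (bvec c))
      (associator_inv H)"

definition p_L :: "('b, 'k::field, 'm) quasi_hopf_scheme \<Rightarrow> ('b \<times> 'b \<Rightarrow> 'k)" where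
  "p_L H =
    linext (basis H \<times> basis H \<times> basis H)
      (\<lambda>(a, b, c).
        tens (amult H (bvec b) (antipode_inv H (amult H (bvec a) (beta H)))) (bvec c))
      (associator H)"

definition canonical_central :: "('b, 'k::field, 'm) quasi_hopf_scheme \<Rightarrow> ('b \<Rightarrow> 'k)" where
  "canonical_central H =
    linext (basis H \<times> basis H) (\<lambda>(a, b). mulb H a b)
      (amult (tensor_alg H H)
        (amult (tensor_alg H H) (q_L H) (comul H (normalized_integral H)))
        (p_L H))"


section \<open>Group data\<close>

definition F_part :: "('g, 'm) monoid_scheme \<Rightarrow> 'g set \<Rightarrow> 'g set \<Rightarrow> 'g \<Rightarrow> 'g" where
  "F_part G F Q g = (THE x. x \<in> F \<and> (\<exists>q\<in>Q. g = x \<otimes>\<^bsub>G\<^esub> q))"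

definition Q_part :: "('g, 'm) monoid_scheme \<Rightarrow> 'g set \<Rightarrow> 'g set \<Rightarrow> 'g \<Rightarrow> 'g" where
  "Q_part G F Q g = (THE q. q \<in> Q \<and> (\<exists>x\<in>F. g = x \<otimes>\<^bsub>G\<^esub> q))"

text \<open>
  \<open>act_F\<close> is \<open>q \<triangleright> x \<in> F\<close> and \<open>act_Q\<close> is \<open>q \<triangleleft> x \<in> Q\<close>, where \<open>qx = (q \<triangleright> x)(q \<triangleleft> x)\<close>;
  \<open>dot\<close> and \<open>theta\<close> are given by \<open>pq = \<theta>(p,q) (p.q)\<close>.
\<close>

definition act_F :: "('g, 'm) monoid_scheme \<Rightarrow> 'g set \<Rightarrow> 'g set \<Rightarrow> 'g \<Rightarrow> 'g \<Rightarrow> 'g" where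
  "act_F G F Q q x = F_part G F Q (q \<otimes>\<^bsub>G\<^esub> x)"

definition act_Q :: "('g, 'm) monoid_scheme \<Rightarrow> 'g set \<Rightarrow> 'g set \<Rightarrow> 'g \<Rightarrow> 'g \<Rightarrow> 'g" where
  "act_Q G F Q q x = Q_part G F Q (q \<otimes>\<^bsub>G\<^esub> x)"

definition theta :: "('g, 'm) monoid_scheme \<Rightarrow> 'g set \<Rightarrow> 'g set \<Rightarrow> 'g \<Rightarrow> 'g \<Rightarrow> 'g" where
  "theta G F Q p q = F_part G F Q (p \<otimes>\<^bsub>G\<^esub> q)"

definition dot :: "('g, 'm) monoid_scheme \<Rightarrow> 'g set \<Rightarrow> 'g set \<Rightarrow> 'g \<Rightarrow> 'g \<Rightarrow> 'g" where
  "dot G F Q p q = Q_part G F Q (p \<otimes>\<^bsub>G\<^esub> q)"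

definition L_inv :: "('g, 'm) monoid_scheme \<Rightarrow> 'g set \<Rightarrow> 'g set \<Rightarrow> 'g \<Rightarrow> 'g" where
  "L_inv G F Q p = (THE l. l \<in> Q \<and> dot G F Q l p = \<one>\<^bsub>G\<^esub>)"

definition R_inv :: "('g, 'm) monoid_scheme \<Rightarrow> 'g set \<Rightarrow> 'g set \<Rightarrow> 'g \<Rightarrow> 'g" where
  "R_inv G F Q p = (THE r. r \<in> Q \<and> dot G F Q p r = \<one>\<^bsub>G\<^esub>)"

text \<open>\<open>p \<succ> x = \<theta>(p, p\<^sup>R)\<^sup>-\<^sup>1 (p \<triangleright> x) \<theta>(p \<triangleleft> x, (p \<triangleleft> x)\<^sup>R)\<close>\<close>

definition succ_F :: "('g, 'm) monoid_scheme \<Rightarrow> 'g set \<Rightarrow> 'g set \<Rightarrow> 'g \<Rightarrow> 'g \<Rightarrow> 'g" where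
  "succ_F G F Q p x =
    inv\<^bsub>G\<^esub> (theta G F Q p (R_inv G F Q p)) \<otimes>\<^bsub>G\<^esub> act_F G F Q p x \<otimes>\<^bsub>G\<^esub>
    theta G F Q (act_Q G F Q p x) (R_inv G F Q (act_Q G F Q p x))"

definition normalized_3_cocycle ::
    "('g, 'm) monoid_scheme \<Rightarrow> ('g \<Rightarrow> 'g \<Rightarrow> 'g \<Rightarrow> 'k::field) \<Rightarrow> bool" where
  "normalized_3_cocycle G \<omega> \<longleftrightarrow>
    (\<forall>a\<in>carrier G. \<forall>b\<in>carrier G. \<forall>c\<in>carrier G. \<omega> a b c \<noteq> 0) \<and>
    (\<forall>a\<in>carrier G. \<forall>b\<in>carrier G. \<forall>c\<in>carrier G. \<forall>d\<in>carrier G.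
      \<omega> (a \<otimes>\<^bsub>G\<^esub> b) c d * \<omega> a b (c \<otimes>\<^bsub>G\<^esub> d) = \<omega> a b c * \<omega> a (b \<otimes>\<^bsub>G\<^esub> c) d * \<omega> b c d) \<and>
    (\<forall>a\<in>carrier G. \<forall>b\<in>carrier G.
      \<omega> \<one>\<^bsub>G\<^esub> a b = 1 \<and> \<omega> a \<one>\<^bsub>G\<^esub> b = 1 \<and> \<omega> a b \<one>\<^bsub>G\<^esub> = 1)"

definition sigma :: "('g \<Rightarrow> 'g \<Rightarrow> 'g \<Rightarrow> 'k) \<Rightarrow> 'g \<Rightarrow> 'g \<Rightarrow> 'g \<Rightarrow> 'k" where
  "sigma \<omega> p x y = \<omega> p x y"

definition tau :: "('g \<Rightarrow> 'g \<Rightarrow> 'g \<Rightarrow> 'k) \<Rightarrow> 'g \<Rightarrow> 'g \<Rightarrow> 'g \<Rightarrow> 'k" where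
  "tau \<omega> x p q = \<omega> p q x"


section \<open>The algebra \<open>A = k\<^sup>Q #\<^sub>\<sigma> kF\<close> and the quasi-Hopf algebra on its opposite\<close>

text \<open>The label \<open>(p, x)\<close> stands for the basis vector \<open>\<delta>\<^sub>p x\<close>.\<close>

definition alg_A ::
    "('g, 'm) monoid_scheme \<Rightarrow> 'g set \<Rightarrow> 'g set \<Rightarrow> ('g \<Rightarrow> 'g \<Rightarrow> 'g \<Rightarrow> 'k::field)
      \<Rightarrow> ('g \<times> 'g, 'k) alg_coalg" where
  "alg_A G F Q \<omega> =
    \<lparr>basis = Q \<times> F,
     mulb = (\<lambda>(p, x) (q, y).
       if act_Q G F Q p x = q then sigma \<omega> p x y *\<^sub>v bvec (p, x \<otimes>\<^bsub>G\<^esub> y) else 0),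
     unit = (\<Sum>p\<in>Q. bvec (p, \<one>\<^bsub>G\<^esub>)),
     comulb = (\<lambda>(p, x).
       \<Sum>(s, t)\<in>{(s, t). s \<in> Q \<and> t \<in> Q \<and> dot G F Q s t = p}.
         tau \<omega> x s t *\<^sub>v tens (bvec (s, act_F G F Q t x)) (bvec (t, x))),
     counitb = (\<lambda>(p, x). if p = \<one>\<^bsub>G\<^esub> then 1 else 0)\<rparr>"

definition quasi_hopf_A_op ::
    "('g, 'm) monoid_scheme \<Rightarrow> 'g set \<Rightarrow> 'g set \<Rightarrow> ('g \<Rightarrow> 'g \<Rightarrow> 'g \<Rightarrow> 'k::field)
      \<Rightarrow> ('g \<times> 'g, 'k) quasi_hopf" where
  "quasi_hopf_A_op G F Q \<omega> =
    \<lparr>basis = basis (alg_A G F Q \<omega>),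
     mulb = (\<lambda>a b. mulb (alg_A G F Q \<omega>) b a),
     unit = unit (alg_A G F Q \<omega>),
     comulb = comulb (alg_A G F Q \<omega>),
     counitb = counitb (alg_A G F Q \<omega>),
     associator =
       (\<Sum>(p, q, r)\<in>Q \<times> Q \<times> Q.
         \<omega> p q r *\<^sub>v
           tens (bvec (p, theta G F Q q r)) (tens (bvec (q, \<one>\<^bsub>G\<^esub>)) (bvec (r, \<one>\<^bsub>G\<^esub>)))),
     antipodeb = (\<lambda>(p, x).
       (inverse (tau \<omega> (succ_F G F Q p x) p (R_inv G F Q p)) *
        inverse (sigma \<omega> (R_inv G F Q p) (succ_F G F Q p x) (inv\<^bsub>G\<^esub> (succ_F G F Q p x)))) *\<^sub>v
       bvec (R_inv G F Q (act_Q G F Q p x), inv\<^bsub>G\<^esub> (succ_F G F Q p x))),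
     alpha = unit (alg_A G F Q \<omega>),
     beta =
       (\<Sum>q\<in>Q. \<omega> (inv\<^bsub>G\<^esub> q) q (inv\<^bsub>G\<^esub> q) *\<^sub>v
         bvec (q, inv\<^bsub>G\<^esub> (theta G F Q (L_inv G F Q q) q)))\<rparr>"

end

theory Submission
  imports Defs
begin

text \<open>
  Multiplying out \<open>m(q\<^sub>L \<Delta>(\<Lambda>) p\<^sub>L)\<close> with \<open>\<Lambda> = |F|\<^sup>-\<^sup>1 \<Sum>\<^sub>x \<delta>\<^sub>e x\<close>, every product of basis vectors is a
  scalar multiple of a basis vector or zero, and the matching conditions determine all summation
  indices except the pair \<open>(t, x)\<close> labelling the term \<open>\<delta>\<^sub>s (t \<triangleright> x) \<otimes> \<delta>\<^sub>t x\<close>, \<open>s = t\<^sup>L\<close>, of \<open>\<Delta>(\<Lambda>)\<close>. The final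
  multiplication keeps the pairs with \<open>t \<triangleleft> x = s\<close> and yields the label
  \<open>x (t \<triangleright> x) s t = (x t)\<^sup>2\<close>. The labels become tractable through the identity
  \<open>p \<succ> x = (p\<^sup>R)\<^sup>-\<^sup>1 x (p \<triangleleft> x)\<^sup>R\<close>. The hypotheses on \<open>\<omega>\<close> give \<open>\<omega>(xg, h, l) = \<omega>(g, h, l)\<close> and
  \<open>\<omega>(g, x, yq) = \<omega>(g, x, y)\<close> for \<open>x, y \<in> F\<close> and \<open>q \<in> Q\<close>; with these, finitely many instances of the
  cocycle identity cancel the antipode and associator factors and convert the remaining scalar
  into either of the two stated forms.
\<close>

section \<open>Linear algebra in coordinates\<close>

text \<open>Matching conditions between basis labels determine one summation index from the others;
  this removes that index. It serves the triple sums defining \<open>q_L\<close> and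
  \<open>p_L\<close>.\<close>

lemma sum_delta_fst:
  assumes "finite A" and "\<And>j. j \<in> J \<Longrightarrow> \<phi> j \<in> A"
    and "\<And>i j. i \<in> A \<Longrightarrow> j \<in> J \<Longrightarrow> i \<noteq> \<phi> j \<Longrightarrow> f (i, j) = 0"
  shows "(\<Sum>k\<in>A \<times> J. f k) = (\<Sum>j\<in>J. f (\<phi> j, j))"
proof -
  have "(\<Sum>i\<in>A. f (i, j)) = f (\<phi> j, j)" if "j \<in> J" for j
  proof -
    have "(\<Sum>i\<in>A. f (i, j)) = (\<Sum>i\<in>A. if i = \<phi> j then f (i, j) else 0)"
      using assms(3) that by (intro sum.cong) auto
    then show ?thesis
      using assms(1,2) that by simp
  qed
  then show ?thesis
    by (simp add: sum.cartesian_product' sum.swap[of _ J A])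
qed

lemma sum_fun_apply: "(\<Sum>i\<in>I. f i) x = (\<Sum>i\<in>I. f i x)" for f :: "'a \<Rightarrow> 'b \<Rightarrow> 'c::comm_monoid_add"
  by (induction I rule: infinite_finite_induct) auto

lemma scale_apply [simp]: "(c *\<^sub>v v) b = c * v b"
  by (simp add: scale_def)

lemma scale_scale [simp]: "c *\<^sub>v d *\<^sub>v v = (c * d) *\<^sub>v v"
  by (simp add: scale_def mult.assoc)

lemma scale_one [simp]: "1 *\<^sub>v v = v"
  and scale_zero [simp]: "0 *\<^sub>v v = 0"
  by (simp_all add: scale_def fun_eq_iff)

lemma scale_sum_right: "c *\<^sub>v (\<Sum>i\<in>I. f i) = (\<Sum>i\<in>I. c *\<^sub>v f i)"
  by (simp add: fun_eq_iff sum_fun_apply sum_distrib_left)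

lemma scale_sum_left: "(\<Sum>i\<in>I. c i) *\<^sub>v v = (\<Sum>i\<in>I. c i *\<^sub>v v)"
  by (simp add: fun_eq_iff sum_fun_apply sum_distrib_right)

lemma bvec_in_vecs: "b \<in> B \<Longrightarrow> bvec b \<in> vecs B"
  by (auto simp: vecs_def bvec_def)

lemma zero_in_vecs: "0 \<in> vecs B"
  by (simp add: vecs_def)

lemma scale_in_vecs: "v \<in> vecs B \<Longrightarrow> c *\<^sub>v v \<in> vecs B"
  by (simp add: vecs_def)

lemma sum_in_vecs: "(\<And>i. i \<in> I \<Longrightarrow> f i \<in> vecs B) \<Longrightarrow> (\<Sum>i\<in>I. f i) \<in> vecs B"
  by (simp add: vecs_def sum_fun_apply)

lemma tens_in_vecs: "u \<in> vecs B \<Longrightarrow> v \<in> vecs C \<Longrightarrow> tens u v \<in> vecs (B \<times> C)"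
  by (auto simp: vecs_def tens_def)

lemma tens_bvec [simp]: "tens (bvec a) (bvec b) = bvec (a, b)"
  by (auto simp: tens_def bvec_def fun_eq_iff)

lemma tens_scale_left [simp]: "tens (c *\<^sub>v u) v = c *\<^sub>v tens u v"
  and tens_scale_right [simp]: "tens u (c *\<^sub>v v) = c *\<^sub>v tens u v"
  and tens_zero_left [simp]: "tens 0 v = 0"
  and tens_zero_right [simp]: "tens u 0 = 0"
  by (auto simp: tens_def fun_eq_iff)

lemma tens_sum_left: "tens (\<Sum>i\<in>I. f i) v = (\<Sum>i\<in>I. tens (f i) v)"
  by (auto simp: tens_def fun_eq_iff sum_fun_apply sum_distrib_right)

lemma tens_sum_right: "tens u (\<Sum>i\<in>I. f i) = (\<Sum>i\<in>I. tens u (f i))"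
  by (auto simp: tens_def fun_eq_iff sum_fun_apply sum_distrib_left)

lemma vecs_expand:
  assumes "finite B" "v \<in> vecs B"
  shows "v = (\<Sum>b\<in>B. v b *\<^sub>v bvec b)"
proof
  fix c
  have "(\<Sum>b\<in>B. v b * bvec b c) = (\<Sum>b\<in>B. if b = c then v b else 0)"
    by (intro sum.cong) (auto simp: bvec_def)
  then show "v c = (\<Sum>b\<in>B. v b *\<^sub>v bvec b) c"
    using assms by (auto simp: sum_fun_apply vecs_def)
qed

lemma linext_sum: "linext B f (\<Sum>i\<in>I. g i) = (\<Sum>i\<in>I. linext B f (g i))"
proof
  fix x
  show "linext B f (\<Sum>i\<in>I. g i) x = (\<Sum>i\<in>I. linext B f (g i)) x"
    using sum.swap[of "\<lambda>b i. g i b * f b x" I B]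
    by (simp add: linext_def sum_fun_apply sum_distrib_right)
qed

lemma linext_scale: "linext B f (c *\<^sub>v v) = c *\<^sub>v linext B f v"
  by (simp add: linext_def scale_sum_right)

lemma linext_bvec:
  assumes "finite B" "b \<in> B"
  shows "linext B f (bvec b) = f b"
proof -
  have "linext B f (bvec b) = (\<Sum>c\<in>B. if c = b then f c else 0)"
    unfolding linext_def by (intro sum.cong) (auto simp: bvec_def)
  then show ?thesis
    using assms by simp
qed

lemma linext_sum_bvec:
  assumes "finite B" "\<And>i. i \<in> I \<Longrightarrow> a i \<in> B"
  shows "linext B f (\<Sum>i\<in>I. c i *\<^sub>v bvec (a i)) = (\<Sum>i\<in>I. c i *\<^sub>v f (a i))"
  using assms by (simp add: linext_sum linext_scale linext_bvec)

section \<open>Bilinearity of the product and products of combinations of basis vectors\<close>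

lemma amult_sum_left: "amult H (\<Sum>i\<in>I. f i) v = (\<Sum>i\<in>I. amult H (f i) v)"
proof -
  have "amult H (\<Sum>i\<in>I. f i) v
      = (\<Sum>a\<in>basis H. \<Sum>b\<in>basis H. \<Sum>i\<in>I. (f i a * v b) *\<^sub>v mulb H a b)"
    by (simp add: amult_def sum_fun_apply sum_distrib_right scale_sum_left)
  also have "\<dots> = (\<Sum>a\<in>basis H. \<Sum>i\<in>I. \<Sum>b\<in>basis H. (f i a * v b) *\<^sub>v mulb H a b)"
    by (intro sum.cong refl) (rule sum.swap)
  also have "\<dots> = (\<Sum>i\<in>I. amult H (f i) v)"
    unfolding amult_def by (rule sum.swap)
  finally show ?thesis .
qed

lemma amult_sum_right: "amult H u (\<Sum>i\<in>I. f i) = (\<Sum>i\<in>I. amult H u (f i))"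
proof -
  have "amult H u (\<Sum>i\<in>I. f i)
      = (\<Sum>a\<in>basis H. \<Sum>b\<in>basis H. \<Sum>i\<in>I. (u a * f i b) *\<^sub>v mulb H a b)"
    by (simp add: amult_def sum_fun_apply sum_distrib_left scale_sum_left)
  also have "\<dots> = (\<Sum>a\<in>basis H. \<Sum>i\<in>I. \<Sum>b\<in>basis H. (u a * f i b) *\<^sub>v mulb H a b)"
    by (intro sum.cong refl) (rule sum.swap)
  also have "\<dots> = (\<Sum>i\<in>I. amult H u (f i))"
    unfolding amult_def by (rule sum.swap)
  finally show ?thesis .
qed

lemma amult_scale_left [simp]: "amult H (c *\<^sub>v u) v = c *\<^sub>v amult H u v"
  and amult_scale_right [simp]: "amult H u (c *\<^sub>v v) = c *\<^sub>v amult H u v"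
  by (simp_all add: amult_def scale_sum_right mult_ac)

lemma amult_zero_left [simp]: "amult H 0 v = 0"
  and amult_zero_right [simp]: "amult H u 0 = 0"
  by (simp_all add: amult_def)

lemma amult_bvec:
  assumes "finite (basis H)" "a \<in> basis H" "b \<in> basis H"
  shows "amult H (bvec a) (bvec b) = mulb H a b"
proof -
  have "amult H (bvec a) (bvec b) = linext (basis H) (\<lambda>c. linext (basis H) (mulb H c) (bvec b)) (bvec a)"
    by (simp add: amult_def linext_def scale_sum_right)
  then show ?thesis
    using assms by (simp add: linext_bvec)
qed

lemma amult_sum_bvec:
  assumes "finite (basis H)"
    and "\<And>i. i \<in> I \<Longrightarrow> a i \<in> basis H" and "\<And>j. j \<in> J \<Longrightarrow> b j \<in> basis H"
  shows "amult H (\<Sum>i\<in>I. c i *\<^sub>v bvec (a i)) (\<Sum>j\<in>J. d j *\<^sub>v bvec (b j))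
    = (\<Sum>i\<in>I. \<Sum>j\<in>J. (c i * d j) *\<^sub>v mulb H (a i) (b j))"
  unfolding amult_sum_left using assms by (simp add: amult_sum_right amult_bvec scale_sum_right mult.commute)

text \<open>Meant for the opposite algebra and its tensor powers, where the right factor prescribes
  the \<open>Q\<close>-component of any left factor it does not annihilate. The double sum then has
  one surviving left index for each right index.\<close>

lemma amult_collapse_left:
  assumes "finite (basis H)" "finite I"
    and "\<And>i. i \<in> I \<Longrightarrow> a i \<in> basis H" and "\<And>j. j \<in> J \<Longrightarrow> b j \<in> basis H"
    and "\<And>j. j \<in> J \<Longrightarrow> \<phi> j \<in> I"
    and "\<And>i j. i \<in> I \<Longrightarrow> j \<in> J \<Longrightarrow> i \<noteq> \<phi> j \<Longrightarrow> mulb H (a i) (b j) = 0"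
  shows "amult H (\<Sum>i\<in>I. c i *\<^sub>v bvec (a i)) (\<Sum>j\<in>J. d j *\<^sub>v bvec (b j))
    = (\<Sum>j\<in>J. (c (\<phi> j) * d j) *\<^sub>v mulb H (a (\<phi> j)) (b j))"
proof -
  have "(\<Sum>i\<in>I. (c i * d j) *\<^sub>v mulb H (a i) (b j)) = (c (\<phi> j) * d j) *\<^sub>v mulb H (a (\<phi> j)) (b j)"
    if "j \<in> J" for j
  proof -
    have "(\<Sum>i\<in>I. (c i * d j) *\<^sub>v mulb H (a i) (b j))
        = (\<Sum>i\<in>I. if i = \<phi> j then (c i * d j) *\<^sub>v mulb H (a i) (b j) else 0)"
      using assms(6) that by (intro sum.cong) auto
    then show ?thesis
      using assms(2,5) that by simp
  qed
  then show ?thesis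
    using assms sum.swap[of "\<lambda>i j. (c i * d j) *\<^sub>v mulb H (a i) (b j)" J I]
    by (simp add: amult_sum_bvec)
qed

text \<open>Mirror image of the preceding collapse: \<open>\<phi>\<close> picks the only right index
  that can survive next to a given left index.\<close>

lemma amult_collapse_right:
  assumes "finite (basis H)" "finite J"
    and "\<And>i. i \<in> I \<Longrightarrow> a i \<in> basis H" and "\<And>j. j \<in> J \<Longrightarrow> b j \<in> basis H"
    and "\<And>i. i \<in> I \<Longrightarrow> \<phi> i \<in> J"
    and "\<And>i j. i \<in> I \<Longrightarrow> j \<in> J \<Longrightarrow> j \<noteq> \<phi> i \<Longrightarrow> mulb H (a i) (b j) = 0"
  shows "amult H (\<Sum>i\<in>I. c i *\<^sub>v bvec (a i)) (\<Sum>j\<in>J. d j *\<^sub>v bvec (b j))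
    = (\<Sum>i\<in>I. (c i * d (\<phi> i)) *\<^sub>v mulb H (a i) (b (\<phi> i)))"
proof -
  have "(\<Sum>j\<in>J. (c i * d j) *\<^sub>v mulb H (a i) (b j)) = (c i * d (\<phi> i)) *\<^sub>v mulb H (a i) (b (\<phi> i))"
    if "i \<in> I" for i
  proof -
    have "(\<Sum>j\<in>J. (c i * d j) *\<^sub>v mulb H (a i) (b j))
        = (\<Sum>j\<in>J. if j = \<phi> i then (c i * d j) *\<^sub>v mulb H (a i) (b j) else 0)"
      using assms(6) that by (intro sum.cong) auto
    then show ?thesis
      using assms(2,5) that by simp
  qed
  then show ?thesis
    using assms by (simp add: amult_sum_bvec)
qed

section \<open>Unital associative algebras and uniqueness of inverses\<close>

definition unital_assoc_alg :: "('b, 'k::field, 'm) alg_scheme \<Rightarrow> bool" where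
  "unital_assoc_alg H \<longleftrightarrow>
    finite (basis H) \<and> unit H \<in> vecs (basis H) \<and>
    (\<forall>a\<in>basis H. \<forall>b\<in>basis H. mulb H a b \<in> vecs (basis H)) \<and>
    (\<forall>a\<in>basis H. amult H (unit H) (bvec a) = bvec a \<and> amult H (bvec a) (unit H) = bvec a) \<and>
    (\<forall>a\<in>basis H. \<forall>b\<in>basis H. \<forall>c\<in>basis H.
      amult H (mulb H a b) (bvec c) = amult H (bvec a) (mulb H b c))"

lemma unital_assoc_alg_unit:
  assumes H: "unital_assoc_alg H" and v: "v \<in> vecs (basis H)"
  shows "amult H (unit H) v = v" and "amult H v (unit H) = v"
proof -
  have v_eq: "v = (\<Sum>b\<in>basis H. v b *\<^sub>v bvec b)"
    using H v by (intro vecs_expand) (auto simp: unital_assoc_alg_def)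
  have "amult H (unit H) (\<Sum>b\<in>basis H. v b *\<^sub>v bvec b) = (\<Sum>b\<in>basis H. v b *\<^sub>v bvec b)"
    using H by (simp add: amult_sum_right unital_assoc_alg_def)
  then show "amult H (unit H) v = v"
    using v_eq by simp
  have "amult H (\<Sum>b\<in>basis H. v b *\<^sub>v bvec b) (unit H) = (\<Sum>b\<in>basis H. v b *\<^sub>v bvec b)"
    using H by (simp add: amult_sum_left unital_assoc_alg_def)
  then show "amult H v (unit H) = v"
    using v_eq by simp
qed

lemma unital_assoc_alg_assoc:
  assumes H: "unital_assoc_alg H"
    and uvw: "u \<in> vecs (basis H)" "v \<in> vecs (basis H)" "w \<in> vecs (basis H)"
  shows "amult H (amult H u v) w = amult H u (amult H v w)"
proof -
  let ?B = "basis H"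
  have fin: "finite ?B"
    using H by (simp add: unital_assoc_alg_def)
  note eqs = vecs_expand[OF fin uvw(1)] vecs_expand[OF fin uvw(2)] vecs_expand[OF fin uvw(3)]
  have "amult H (amult H (\<Sum>a\<in>?B. u a *\<^sub>v bvec a) (\<Sum>b\<in>?B. v b *\<^sub>v bvec b)) (\<Sum>c\<in>?B. w c *\<^sub>v bvec c)
      = amult H (\<Sum>a\<in>?B. u a *\<^sub>v bvec a) (amult H (\<Sum>b\<in>?B. v b *\<^sub>v bvec b) (\<Sum>c\<in>?B. w c *\<^sub>v bvec c))"
    using H fin
    by (simp add: amult_sum_left amult_sum_right amult_bvec scale_sum_right unital_assoc_alg_def mult_ac)
  then show ?thesis
    using eqs by simp
qed

text \<open>In a unital associative algebra two-sided inverses are unique, so the definite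
  description behind \<open>alg_inverse\<close> reduces to checking one candidate.\<close>

lemma alg_inverse_eq:
  assumes "unital_assoc_alg H" "u \<in> vecs (basis H)" "v \<in> vecs (basis H)"
    and "amult H u v = unit H" "amult H v u = unit H"
  shows "alg_inverse H u = v"
  unfolding alg_inverse_def
proof (rule the_equality)
  fix w
  assume w: "w \<in> vecs (basis H) \<and> amult H u w = unit H \<and> amult H w u = unit H"
  then have "w = amult H (amult H v u) w"
    using assms by (simp add: unital_assoc_alg_unit)
  also have "\<dots> = amult H v (amult H u w)"
    using assms(1-3) w by (intro unital_assoc_alg_assoc) auto
  also have "\<dots> = v"
    using assms w by (simp add: unital_assoc_alg_unit)
  finally show "w = v" .
qed (use assms in auto)

lemma amult_tensor_tens:
  "amult (tensor_alg H K) (tens u v) (tens u' v') = tens (amult H u u') (amult K v v')"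
proof -
  have "amult (tensor_alg H K) (tens u v) (tens u' v')
      = (\<Sum>a\<in>basis H. \<Sum>b\<in>basis K. \<Sum>a'\<in>basis H. \<Sum>b'\<in>basis K.
          (u a * u' a') *\<^sub>v (v b * v' b') *\<^sub>v tens (mulb H a a') (mulb K b b'))"
    by (simp add: amult_def tensor_alg_def sum.cartesian_product' tens_def[of u] tens_def[of u'] mult_ac)
  also have "\<dots> = (\<Sum>a\<in>basis H. \<Sum>a'\<in>basis H. \<Sum>b\<in>basis K. \<Sum>b'\<in>basis K.
          (u a * u' a') *\<^sub>v (v b * v' b') *\<^sub>v tens (mulb H a a') (mulb K b b'))"
    by (intro sum.cong refl) (rule sum.swap)
  also have "\<dots> = tens (amult H u u') (amult K v v')"
    unfolding amult_def tens_sum_left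
    by (simp add: tens_sum_right scale_sum_right mult_ac)
  finally show ?thesis .
qed

text \<open>Applied twice, this reaches the triple tensor power, in which the associator has to be
  inverted.\<close>

lemma unital_assoc_alg_tensor:
  assumes "unital_assoc_alg H" "unital_assoc_alg K"
  shows "unital_assoc_alg (tensor_alg H K)"
proof -
  have *: "basis (tensor_alg H K) = basis H \<times> basis K"
    "unit (tensor_alg H K) = tens (unit H) (unit K)"
    "mulb (tensor_alg H K) (a, b) (a', b') = tens (mulb H a a') (mulb K b b')" for a b a' b'
    by (auto simp: tensor_alg_def)
  show ?thesis
    using assms unfolding unital_assoc_alg_def *
    by (auto simp: * tens_in_vecs simp flip: tens_bvec simp: amult_tensor_tens)
qed


section \<open>Two-sided transversals\<close>

locale transversal = group G for G :: "('g, 'm) monoid_scheme" (structure) +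
  fixes F Q :: "'g set"
  assumes finite_carrier: "finite (carrier G)"
    and subgroup_F: "subgroup F G"
    and Q_subset: "Q \<subseteq> carrier G"
    and one_Q [simp]: "\<one> \<in> Q"
    and right_transversal: "\<And>g. g \<in> carrier G \<Longrightarrow> \<exists>!q. q \<in> Q \<and> q \<in> F #> g"
    and left_transversal: "\<And>g. g \<in> carrier G \<Longrightarrow> \<exists>!q. q \<in> Q \<and> q \<in> g <# F"
begin

abbreviation "Fp \<equiv> F_part G F Q"
abbreviation "Qp \<equiv> Q_part G F Q"
abbreviation "af \<equiv> act_F G F Q"
abbreviation "aq \<equiv> act_Q G F Q"
abbreviation "th \<equiv> theta G F Q"
abbreviation "Li \<equiv> L_inv G F Q"
abbreviation "Ri \<equiv> R_inv G F Q"
abbreviation "sc \<equiv> succ_F G F Q"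

lemma F_carrier [simp]: "x \<in> F \<Longrightarrow> x \<in> carrier G"
  using subgroup.mem_carrier[OF subgroup_F] .

lemma Q_carrier [simp]: "q \<in> Q \<Longrightarrow> q \<in> carrier G"
  using Q_subset by auto

lemma F_closed [simp]: "x \<in> F \<Longrightarrow> y \<in> F \<Longrightarrow> x \<otimes> y \<in> F"
  "x \<in> F \<Longrightarrow> inv x \<in> F" "\<one> \<in> F"
  using subgroup_F by (auto simp: subgroup.m_closed subgroup.m_inv_closed subgroup.one_closed)

lemma F_cancel_left:
  assumes "x \<in> F" "g \<in> carrier G"
  shows "x \<otimes> g \<in> F \<longleftrightarrow> g \<in> F"
proof
  assume "x \<otimes> g \<in> F"
  moreover have "g = inv x \<otimes> (x \<otimes> g)"
    using assms by (simp flip: m_assoc)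
  ultimately show "g \<in> F"
    using assms(1) F_closed(1,2) by metis
qed (use assms in simp)

lemma finite_F [simp]: "finite F" and finite_Q [simp]: "finite Q"
  by (auto intro: finite_subset[OF _ finite_carrier])

section \<open>Unique factorization into an element of \<open>F\<close> and an element of
  \<open>Q\<close>\<close>

lemma decomposition:
  assumes "g \<in> carrier G"
  obtains x q where "x \<in> F" "q \<in> Q" "g = x \<otimes> q"
proof -
  obtain y q where y: "y \<in> F" "q \<in> Q" "q = y \<otimes> g"
    using right_transversal[OF assms] by (auto simp: r_coset_def)
  have "g = inv y \<otimes> q"
    using y assms by (simp flip: m_assoc)
  with y(1,2) show ?thesis
    by (intro that[of "inv y" q]) simp_all
qed

lemma decomposition_unique:
  assumes "x \<in> F" "y \<in> F" "p \<in> Q" "q \<in> Q" "x \<otimes> p = y \<otimes> q"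
  shows "x = y" and "p = q"
proof -
  have "p = inv x \<otimes> (x \<otimes> p)" "q = inv y \<otimes> (y \<otimes> q)"
    using assms(1-4) by (simp_all flip: m_assoc)
  then have "p \<in> F #> (x \<otimes> p)" "q \<in> F #> (x \<otimes> p)"
    using assms(1-4) F_closed(2) unfolding r_coset_def assms(5)[symmetric] by blast+
  then show "p = q"
    using right_transversal[of "x \<otimes> p"] assms(1-4) by auto
  then show "x = y"
    using assms by simp
qed

lemma F_part_mult [simp]: "x \<in> F \<Longrightarrow> q \<in> Q \<Longrightarrow> Fp (x \<otimes> q) = x"
  unfolding F_part_def by (rule the_equality) (auto dest: decomposition_unique)

lemma Q_part_mult [simp]: "x \<in> F \<Longrightarrow> q \<in> Q \<Longrightarrow> Qp (x \<otimes> q) = q"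
  unfolding Q_part_def by (rule the_equality) (auto dest: decomposition_unique)

lemma parts:
  assumes "g \<in> carrier G"
  shows "Fp g \<in> F" and "Qp g \<in> Q" and "Fp g \<otimes> Qp g = g"
  using assms by (auto elim!: decomposition)

text \<open>\<open>Qp\<close> depends only on the coset of \<open>F\<close> through
  \<open>g\<close>, so left factors from \<open>F\<close> are invisible to it. The action law for
  \<open>aq\<close> rests on this.\<close>

lemma Q_part_mult_left:
  assumes "x \<in> F" "g \<in> carrier G"
  shows "Qp (x \<otimes> g) = Qp g"
  using assms(2)
proof (rule decomposition)
  fix y q assume "y \<in> F" "q \<in> Q" "g = y \<otimes> q"
  then show ?thesis
    using assms Q_part_mult[of "x \<otimes> y" q] by (simp add: m_assoc)
qed

lemma parts_F [simp]:
  assumes "x \<in> F"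
  shows "Fp x = x" and "Qp x = \<one>"
  using F_part_mult[of x \<one>] Q_part_mult[of x \<one>] assms by simp_all

text \<open>Replaces the nonassociative product on \<open>Q\<close> by membership in
  \<open>F\<close>, so that one-sided inverses can be handled by computing in the group.\<close>

lemma dot_eq_one_iff:
  assumes "p \<in> Q" "q \<in> Q"
  shows "dot G F Q p q = \<one> \<longleftrightarrow> p \<otimes> q \<in> F"
proof
  assume "dot G F Q p q = \<one>"
  then show "p \<otimes> q \<in> F"
    using parts[of "p \<otimes> q"] assms by (simp add: dot_def)
qed (simp add: dot_def)

lemma theta_closed [simp]: "p \<in> Q \<Longrightarrow> q \<in> Q \<Longrightarrow> th p q \<in> F"
  by (simp add: theta_def parts)

lemma theta_eq_mult: "p \<otimes> q \<in> F \<Longrightarrow> th p q = p \<otimes> q"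
  by (simp add: theta_def)

section \<open>The maps \<open>af\<close> and \<open>aq\<close>, and the right action of
  \<open>F\<close> on \<open>Q\<close>\<close>

lemma act_closed [simp]:
  assumes "q \<in> Q" "x \<in> F"
  shows "af q x \<in> F" and "aq q x \<in> Q"
  using assms by (simp_all add: act_F_def act_Q_def parts)

lemma act_mult: "q \<in> Q \<Longrightarrow> x \<in> F \<Longrightarrow> af q x \<otimes> aq q x = q \<otimes> x"
  by (simp add: act_F_def act_Q_def parts)

lemma act_eqI:
  assumes "q \<in> Q" "x \<in> F" "p \<in> Q" "y \<in> F" "q \<otimes> x = y \<otimes> p"
  shows "af q x = y" and "aq q x = p"
  using assms by (simp_all add: act_F_def act_Q_def)

lemma act_Q_one [simp]: "q \<in> Q \<Longrightarrow> aq q \<one> = q"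
  by (rule act_eqI(2)[of _ _ _ \<one>]) auto

lemma act_one_Q [simp]: "x \<in> F \<Longrightarrow> af \<one> x = x" "x \<in> F \<Longrightarrow> aq \<one> x = \<one>"
  by (simp_all add: act_F_def act_Q_def)

lemma act_Q_act_Q:
  assumes "q \<in> Q" "x \<in> F" "y \<in> F"
  shows "aq (aq q x) y = aq q (x \<otimes> y)"
proof -
  have "q \<otimes> (x \<otimes> y) = af q x \<otimes> (aq q x \<otimes> y)"
    using assms by (simp add: act_mult flip: m_assoc)
  then show ?thesis
    using assms by (simp add: act_Q_def[of _ _ _ q "x \<otimes> y"] Q_part_mult_left act_Q_def[of _ _ _ "aq q x"])
qed

lemma act_Q_inv [simp]:
  assumes "q \<in> Q" "x \<in> F"
  shows "aq (aq q x) (inv x) = q" and "aq (aq q (inv x)) x = q"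
  using assms by (simp_all add: act_Q_act_Q)

lemma act_Q_eq_iff: "p \<in> Q \<Longrightarrow> q \<in> Q \<Longrightarrow> x \<in> F \<Longrightarrow> aq p x = aq q x \<longleftrightarrow> p = q"
  by (metis act_Q_inv(1))

text \<open>The left inverses of \<open>p\<close> are the elements of \<open>Q\<close> in the right
  coset of \<open>F\<close> through \<open>inv p\<close>, and such a coset meets \<open>Q\<close>
  once.\<close>

lemma L_inv_unique:
  assumes "p \<in> Q"
  shows "\<exists>!l. l \<in> Q \<and> dot G F Q l p = \<one>"
proof -
  have "l \<otimes> p \<in> F \<longleftrightarrow> l \<in> F #> inv p" if "l \<in> Q" for l
  proof
    assume "l \<otimes> p \<in> F"
    then have "(l \<otimes> p) \<otimes> inv p \<in> F #> inv p"
      unfolding r_coset_def by blast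
    then show "l \<in> F #> inv p"
      using assms that by (simp add: m_assoc)
  next
    assume "l \<in> F #> inv p"
    then show "l \<otimes> p \<in> F"
      using assms by (auto simp: r_coset_def m_assoc)
  qed
  then show ?thesis
    using right_transversal[of "inv p"] assms by (auto simp: dot_eq_one_iff)
qed

text \<open>Here the candidates form the left coset of \<open>F\<close> through
  \<open>inv p\<close>; this is where \<open>Q\<close> has to represent the left cosets as
  well.\<close>

lemma R_inv_unique:
  assumes "p \<in> Q"
  shows "\<exists>!r. r \<in> Q \<and> dot G F Q p r = \<one>"
proof -
  have "p \<otimes> r \<in> F \<longleftrightarrow> r \<in> inv p <# F" if "r \<in> Q" for r
  proof
    assume "p \<otimes> r \<in> F"
    then have "inv p \<otimes> (p \<otimes> r) \<in> inv p <# F"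
      unfolding l_coset_def by blast
    then show "r \<in> inv p <# F"
      using assms that by (simp flip: m_assoc)
  next
    assume "r \<in> inv p <# F"
    then show "p \<otimes> r \<in> F"
      using assms by (auto simp: l_coset_def simp flip: m_assoc)
  qed
  then show ?thesis
    using left_transversal[of "inv p"] assms by (auto simp: dot_eq_one_iff)
qed

lemma L_inv [simp]:
  assumes "p \<in> Q"
  shows "Li p \<in> Q" and "Li p \<otimes> p \<in> F"
  using theI'[OF L_inv_unique[OF assms]] assms
  by (auto simp: L_inv_def dot_eq_one_iff)

lemma R_inv [simp]:
  assumes "p \<in> Q"
  shows "Ri p \<in> Q" and "p \<otimes> Ri p \<in> F"
  using theI'[OF R_inv_unique[OF assms]] assms
  by (auto simp: R_inv_def dot_eq_one_iff)

lemma L_inv_eqI: "p \<in> Q \<Longrightarrow> q \<in> Q \<Longrightarrow> q \<otimes> p \<in> F \<Longrightarrow> Li p = q"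
  using L_inv_unique[of p] L_inv[of p] by (metis dot_eq_one_iff)

lemma R_inv_eqI: "p \<in> Q \<Longrightarrow> q \<in> Q \<Longrightarrow> p \<otimes> q \<in> F \<Longrightarrow> Ri p = q"
  using R_inv_unique[of p] R_inv[of p] by (metis dot_eq_one_iff)

lemma R_inv_L_inv [simp]: "p \<in> Q \<Longrightarrow> Ri (Li p) = p"
  by (simp add: R_inv_eqI)

lemma L_inv_R_inv [simp]: "p \<in> Q \<Longrightarrow> Li (Ri p) = p"
  by (simp add: L_inv_eqI)

text \<open>The two values of \<open>theta\<close> are the plain products
  \<open>p \<otimes> Ri p\<close> and \<open>aq p x \<otimes> Ri (aq p x)\<close>; with
  \<open>af p x \<otimes> aq p x = p \<otimes> x\<close> the factor \<open>p\<close> cancels. Labels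
  produced by the antipode thereby become products in the group.\<close>

lemma succ_eq:
  assumes "p \<in> Q" "x \<in> F"
  shows "sc p x = inv (Ri p) \<otimes> x \<otimes> Ri (aq p x)"
proof -
  have "af p x \<otimes> (aq p x \<otimes> Ri (aq p x)) = p \<otimes> x \<otimes> Ri (aq p x)"
    using assms by (simp add: act_mult flip: m_assoc)
  then show ?thesis
    using assms by (simp add: succ_F_def theta_eq_mult inv_mult_group m_assoc)
      (simp add: inv_solve_left flip: m_assoc)
qed

lemma succ_closed [simp]: "p \<in> Q \<Longrightarrow> x \<in> F \<Longrightarrow> sc p x \<in> F"
  by (simp add: succ_F_def)

text \<open>Factoring \<open>Li t \<otimes> t \<otimes> x\<close> by moving \<open>x\<close> to the
  left past \<open>t\<close> and then past \<open>Li t\<close> leaves the two acted-on elements of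
  \<open>Q\<close> at the end; as the whole product lies in \<open>F\<close>, so does
  theirs.\<close>

lemma act_Q_L_inv:
  assumes "t \<in> Q" "x \<in> F"
  shows "aq (Li t) (af t x) = Li (aq t x)"
proof (rule L_inv_eqI[symmetric])
  have "af (Li t) (af t x) \<otimes> (aq (Li t) (af t x) \<otimes> aq t x) = (Li t \<otimes> t) \<otimes> x"
    using assms by (simp add: act_mult flip: m_assoc) (simp add: act_mult m_assoc)
  then show "aq (Li t) (af t x) \<otimes> aq t x \<in> F"
    using assms F_cancel_left[of "af (Li t) (af t x)" "aq (Li t) (af t x) \<otimes> aq t x"] by simp
qed (use assms in auto)

text \<open>The antipode sends the label \<open>(p, x)\<close> to \<open>(a, v)\<close> with
  \<open>a = Ri (aq p x)\<close> and \<open>v = inv (sc p x)\<close>, and then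
  \<open>a \<otimes> v = inv x \<otimes> Ri p\<close>. Factoring \<open>a \<otimes> v\<close>
  therefore recovers \<open>x\<close> and \<open>p\<close>.\<close>

lemma antipode_label_inverse:
  assumes "a \<in> Q" "v \<in> F"
  defines "p \<equiv> Li (Qp (a \<otimes> v))" and "x \<equiv> inv (Fp (a \<otimes> v))"
  shows "p \<in> Q" and "x \<in> F" and "Ri (aq p x) = a" and "inv (sc p x) = v"
proof -
  note av = parts[of "a \<otimes> v"]
  show p: "p \<in> Q" and x: "x \<in> F"
    using assms av by auto
  have "inv x \<otimes> Ri p = a \<otimes> v"
    using assms av by (simp add: p_def x_def)
  then have "x \<otimes> (inv x \<otimes> Ri p) \<otimes> inv v = x \<otimes> (a \<otimes> v) \<otimes> inv v"
    by simp
  moreover have "x \<otimes> (inv x \<otimes> Ri p) = Ri p"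
    using p x by (simp flip: m_assoc)
  moreover have "x \<otimes> (a \<otimes> v) \<otimes> inv v = x \<otimes> a"
    using assms(1,2) x by (simp add: m_assoc)
  ultimately have *: "x \<otimes> a = Ri p \<otimes> inv v"
    by simp
  \<comment> \<open>Stripping the factor \<open>af p x\<close> from this element of \<open>F\<close>
    exhibits \<open>a\<close> as the right inverse of \<open>aq p x\<close>.\<close>
  have "af p x \<otimes> (aq p x \<otimes> a) = p \<otimes> (x \<otimes> a)"
    using assms(1,2) p x by (simp add: act_mult flip: m_assoc)
  also have "\<dots> = (p \<otimes> Ri p) \<otimes> inv v"
    using assms(1,2) p x by (simp add: * m_assoc)
  finally have "aq p x \<otimes> a \<in> F"
    using assms(1,2) p x F_cancel_left[of "af p x" "aq p x \<otimes> a"] by simp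
  then show Ri: "Ri (aq p x) = a"
    using assms(1) p x by (simp add: R_inv_eqI)
  have "sc p x = inv (Ri p) \<otimes> (x \<otimes> a)"
    using assms(1) p x by (simp add: succ_eq Ri m_assoc)
  also have "\<dots> = inv v"
    using assms(1,2) p x by (simp add: * flip: m_assoc)
  finally show "inv (sc p x) = v"
    using assms(2) by simp
qed

text \<open>Together with the preceding lemma this makes the label map of the antipode a bijection
  of \<open>Q \<times> F\<close>.\<close>

lemma antipode_label:
  assumes "p \<in> Q" "x \<in> F"
  defines "a \<equiv> Ri (aq p x)" and "v \<equiv> inv (sc p x)"
  shows "Li (Qp (a \<otimes> v)) = p" and "inv (Fp (a \<otimes> v)) = x"
proof -
  have "a \<otimes> v = inv x \<otimes> Ri p"
    using assms(1,2) by (simp add: a_def v_def succ_eq inv_mult_group flip: m_assoc)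
  then show "Li (Qp (a \<otimes> v)) = p" and "inv (Fp (a \<otimes> v)) = x"
    using assms(1,2) by simp_all
qed

lemma parts_Q [simp]:
  assumes "q \<in> Q"
  shows "Fp q = \<one>" and "Qp q = q"
  using F_part_mult[of \<one> q] Q_part_mult[of \<one> q] assms by simp_all

lemma act_Q_eq_one_iff: "q \<in> Q \<Longrightarrow> x \<in> F \<Longrightarrow> aq q x = \<one> \<longleftrightarrow> q = \<one>"
  by (metis act_Q_inv(1) act_one_Q(2) F_closed(2))

text \<open>Both bracketings of \<open>Li (Li q) \<otimes> Li q \<otimes> q\<close> contain a
  product lying in \<open>F\<close>; comparing them moves \<open>theta\<close> from right to
  left.\<close>

lemma act_Q_L_inv_L_inv:
  assumes "q \<in> Q"
  shows "aq (Li (Li q)) (th (Li q) q) = q"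
proof (rule act_eqI(2))
  show "Li (Li q) \<otimes> th (Li q) q = (Li (Li q) \<otimes> Li q) \<otimes> q"
    using assms by (simp add: theta_eq_mult m_assoc)
qed (use assms in auto)

lemma act_Q_inv_theta:
  assumes "q \<in> Q"
  shows "aq q (inv (th (Li q) q)) = Li (Li q)"
  using act_Q_inv(1)[of "Li (Li q)" "th (Li q) q"] assms by (simp add: act_Q_L_inv_L_inv)

lemma succ_inv_theta:
  assumes "q \<in> Q"
  shows "sc q (inv (th (Li q) q)) = inv (q \<otimes> Ri q)"
proof -
  have "sc q (inv (th (Li q) q)) = inv (Ri q) \<otimes> inv (th (Li q) q) \<otimes> Li q"
    using assms by (simp add: succ_eq act_Q_inv_theta)
  then show ?thesis
    using assms by (simp add: theta_eq_mult inv_mult_group m_assoc)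
qed

end


section \<open>Cocycle identities\<close>

locale transversal_cocycle = transversal G F Q for G :: "('g, 'm) monoid_scheme" (structure) and F Q +
  fixes \<omega> :: "'g \<Rightarrow> 'g \<Rightarrow> 'g \<Rightarrow> 'k::field_char_0"
  assumes normalized_cocycle: "normalized_3_cocycle G \<omega>"
    and cocycle_F_left: "\<And>x g h. x \<in> F \<Longrightarrow> g \<in> carrier G \<Longrightarrow> h \<in> carrier G \<Longrightarrow> \<omega> x g h = 1"
    and cocycle_F_mid: "\<And>g x q. g \<in> carrier G \<Longrightarrow> x \<in> F \<Longrightarrow> q \<in> Q \<Longrightarrow> \<omega> g x q = 1"
begin

lemma cocycle:
  assumes "a \<in> carrier G" "b \<in> carrier G" "c \<in> carrier G" "d \<in> carrier G"
  shows "\<omega> (a \<otimes> b) c d * \<omega> a b (c \<otimes> d) = \<omega> a b c * \<omega> a (b \<otimes> c) d * \<omega> b c d"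
  using normalized_cocycle assms by (simp add: normalized_3_cocycle_def)

lemma cocycle_nonzero [simp]:
  "a \<in> carrier G \<Longrightarrow> b \<in> carrier G \<Longrightarrow> c \<in> carrier G \<Longrightarrow> \<omega> a b c \<noteq> 0"
  using normalized_cocycle by (simp add: normalized_3_cocycle_def)

lemma cocycle_one [simp]:
  assumes "a \<in> carrier G" "b \<in> carrier G"
  shows "\<omega> \<one> a b = 1" "\<omega> a \<one> b = 1" "\<omega> a b \<one> = 1"
  using normalized_cocycle assms by (simp_all add: normalized_3_cocycle_def)

text \<open>In the cocycle identity at \<open>(x, a, b, c)\<close> three factors have first argument
  \<open>x\<close> and equal 1.\<close>

lemma cocycle_F_mult_left:
  assumes "x \<in> F" "a \<in> carrier G" "b \<in> carrier G" "c \<in> carrier G"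
  shows "\<omega> (x \<otimes> a) b c = \<omega> a b c"
  using cocycle[of x a b c] assms by (simp add: cocycle_F_left)

text \<open>In the cocycle identity at \<open>(a, x, y, q)\<close> two factors have middle argument
  in \<open>F\<close> and last argument \<open>q\<close>, and one has first argument
  \<open>x\<close>; all three equal 1.\<close>

lemma cocycle_F_mult_right:
  assumes "a \<in> carrier G" "x \<in> F" "y \<in> F" "q \<in> Q"
  shows "\<omega> a x (y \<otimes> q) = \<omega> a x y"
  using cocycle[of a x y q] assms by (simp add: cocycle_F_left cocycle_F_mid)

lemma cocycle_act_Q:
  assumes "q \<in> Q" "x \<in> F" "b \<in> carrier G" "c \<in> carrier G"
  shows "\<omega> (q \<otimes> x) b c = \<omega> (aq q x) b c"
  using cocycle_F_mult_left[of "af q x" "aq q x" b c] assms by (simp add: act_mult)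

text \<open>The 2-cocycle condition twisted by the action of \<open>F\<close> on \<open>Q\<close>;
  it is what makes the crossed product associative.\<close>

lemma sigma_cocycle:
  assumes "q \<in> Q" "x \<in> F" "y \<in> F" "z \<in> F"
  shows "\<omega> (aq q x) y z * \<omega> q x (y \<otimes> z) = \<omega> q x y * \<omega> q (x \<otimes> y) z"
  using cocycle[of q x y z] assms by (simp add: cocycle_act_Q cocycle_F_left)

lemma sigma_inv_commute:
  assumes "q \<in> Q" "x \<in> F"
  shows "\<omega> (aq q x) (inv x) x = \<omega> q x (inv x)"
  using sigma_cocycle[of q x "inv x" x] assms by simp

text \<open>The left side is the scalar of \<open>beta\<close> at \<open>t\<close>, entering through
  \<open>p_L\<close>. The right side lists factors that occur inverted in \<open>q_L\<close>, so the
  two will cancel.\<close>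

lemma cocycle_inv_eq:
  assumes "t \<in> Q"
  defines "s \<equiv> Li t"
  defines "g \<equiv> Li s \<otimes> s"
  shows "\<omega> (inv t) t (inv t) = \<omega> (Li (Li s)) (Li s) s * \<omega> (Li (Li s)) g (inv g) * \<omega> s t (inv (s \<otimes> t))"
proof -
  define p u f where "p = Li (Li s)" and "u = Li s" and "f = s \<otimes> t"
  have s: "s \<in> Q" "u \<in> Q" "p \<in> Q" and f: "f \<in> F" "g \<in> F" "p \<otimes> u \<in> F"
    using assms by (simp_all add: p_def u_def f_def)
  have "inv t = inv f \<otimes> s"
    using assms(1) s by (simp add: f_def inv_mult_group m_assoc)
  then have "\<omega> (inv t) t (inv t) = \<omega> s t (inv f \<otimes> s)"
    using assms(1) s f by (simp add: cocycle_F_mult_left)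
  also have "\<dots> = \<omega> s t (inv f) * \<omega> s (t \<otimes> inv f) s"
    using cocycle[of s t "inv f" s] assms(1) s f
    by (simp add: f_def[symmetric] cocycle_F_left cocycle_F_mid)
  also have "t \<otimes> inv f = inv s"
    using assms(1) s by (simp add: f_def inv_mult_group flip: m_assoc)
  \<comment> \<open>Up to a left factor in \<open>F\<close> the first argument \<open>s\<close> is
    \<open>p \<otimes> g\<close>, and \<open>inv s = inv g \<otimes> u\<close>. This form allows the
    cocycle identity at \<open>(p, g, inv g \<otimes> u, s)\<close>.\<close>
  also have "\<omega> s (inv s) s = \<omega> (p \<otimes> g) (inv g \<otimes> u) s"
  proof -
    have "p \<otimes> g = (p \<otimes> u) \<otimes> s"
      using s by (simp add: g_def u_def m_assoc)
    moreover have "inv g \<otimes> u = inv s"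
      using s by (simp add: g_def u_def[symmetric] inv_mult_group m_assoc)
    ultimately show ?thesis
      using s f by (simp add: cocycle_F_mult_left)
  qed
  also have "\<dots> = \<omega> p g (inv g) * \<omega> p u s"
  proof -
    have "inv g \<otimes> u \<otimes> s = \<one>" "g \<otimes> (inv g \<otimes> u) = u"
      using s f by (simp_all add: m_assoc g_def[folded u_def, symmetric]) (simp flip: m_assoc)
    then show ?thesis
      using cocycle[of p g "inv g \<otimes> u" s] s f by (simp add: cocycle_F_left cocycle_F_mult_right)
  qed
  finally show ?thesis
    by (simp add: p_def u_def f_def)
qed

text \<open>The condition on \<open>(t, x)\<close> says
  \<open>t \<otimes> x = y \<otimes> s\<close>. The first equation is the cocycle identity at
  \<open>(t, x, y, s \<otimes> t)\<close> and links the two stated formulas; the second combines the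
  identities at \<open>(s, y, s, t)\<close>, \<open>(s, t, x, t)\<close> and
  \<open>(t, x, t, x \<otimes> t)\<close>.\<close>

lemma cocycle_act_eq:
  assumes "t \<in> Q" "x \<in> F" and s: "aq t x = Li t"
  defines "s \<equiv> Li t" and "y \<equiv> af t x"
  shows "\<omega> s y (s \<otimes> t) * \<omega> t x (y \<otimes> (s \<otimes> t)) = \<omega> t x y * \<omega> t (x \<otimes> y) (s \<otimes> t)"
    and "\<omega> (x \<otimes> t) (x \<otimes> t) (x \<otimes> t)
      = \<omega> s t x * \<omega> (Li s) s t * (\<omega> s y (s \<otimes> t) * \<omega> t x (y \<otimes> (s \<otimes> t)))"
proof -
  have sQ: "s \<in> Q" "Li s \<in> Q" and y: "y \<in> F" "s \<otimes> t \<in> F"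
    using assms by auto
  have tx: "t \<otimes> x = y \<otimes> s"
    using act_mult[of t x] assms by simp
  show "\<omega> s y (s \<otimes> t) * \<omega> t x (y \<otimes> (s \<otimes> t)) = \<omega> t x y * \<omega> t (x \<otimes> y) (s \<otimes> t)"
    using cocycle[of t x y "s \<otimes> t"] assms(1,2) sQ y by (simp add: tx cocycle_F_mult_left cocycle_F_left)
  have "aq s y = Li s"
    using act_Q_L_inv[of t x] assms by simp
  then have "\<omega> (Li s) s t * \<omega> s y (s \<otimes> t) = \<omega> s (y \<otimes> s) t"
    using cocycle[of s y s t] assms(1,2) sQ y
    by (simp add: cocycle_act_Q cocycle_F_left cocycle_F_mid)
  moreover have "\<omega> s t (x \<otimes> t) = \<omega> s t x * \<omega> s (y \<otimes> s) t"
    using cocycle[of s t x t] assms(1,2) sQ y by (simp add: tx cocycle_F_left cocycle_F_mid)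
  moreover have "\<omega> s t (x \<otimes> t) * \<omega> t x (y \<otimes> (s \<otimes> t)) = \<omega> t (x \<otimes> t) (x \<otimes> t)"
  proof -
    have "t \<otimes> (x \<otimes> t) = y \<otimes> (s \<otimes> t)"
      using assms(1,2) sQ y by (simp add: tx flip: m_assoc)
    then show ?thesis
      using cocycle[of t x t "x \<otimes> t"] assms(1,2) sQ y
      by (simp add: tx cocycle_F_mult_left cocycle_F_left cocycle_F_mid)
  qed
  moreover have "\<omega> (x \<otimes> t) (x \<otimes> t) (x \<otimes> t) = \<omega> t (x \<otimes> t) (x \<otimes> t)"
    using assms(1,2) by (simp add: cocycle_F_mult_left)
  ultimately show "\<omega> (x \<otimes> t) (x \<otimes> t) (x \<otimes> t)
      = \<omega> s t x * \<omega> (Li s) s t * (\<omega> s y (s \<otimes> t) * \<omega> t x (y \<otimes> (s \<otimes> t)))"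
    by (metis mult.assoc)
qed


subsection \<open>The algebra, its integral and its antipode\<close>

abbreviation "H \<equiv> quasi_hopf_A_op G F Q \<omega>"

text \<open>The coefficient 1 in \<open>H_unit\<close> gives the unit the shape expected by the
  collapse lemmas. Because the product is opposite, the action in \<open>H_mulb\<close> is that of
  the right factor.\<close>

lemma H_basis [simp]: "basis H = Q \<times> F"
  and H_unit: "unit H = (\<Sum>p\<in>Q. 1 *\<^sub>v bvec (p, \<one>))"
  and H_alpha: "alpha H = unit H"
  and H_mulb: "mulb H (p, x) (q, y) = (if aq q y = p then \<omega> q y x *\<^sub>v bvec (q, y \<otimes> x) else 0)"
  and H_counitb: "counitb H (p, x) = (if p = \<one> then 1 else 0)"
  by (auto simp: quasi_hopf_A_op_def alg_A_def sigma_def)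

lemma unital_assoc_alg_H: "unital_assoc_alg H"
  unfolding unital_assoc_alg_def
proof (intro conjI ballI)
  show "finite (basis H)"
    by simp
  show "unit H \<in> vecs (basis H)"
    by (auto simp: H_unit intro!: sum_in_vecs bvec_in_vecs)
  fix a assume a: "a \<in> basis H"
  obtain p x where px [simp]: "a = (p, x)" "p \<in> Q" "x \<in> F"
    using a by auto
  have a_sum: "bvec a = (\<Sum>i\<in>{a}. 1 *\<^sub>v bvec i)"
    by simp
  have "amult H (unit H) (bvec a) = (\<Sum>j\<in>{a}. (1 * 1) *\<^sub>v mulb H (aq p x, \<one>) j)"
    unfolding H_unit a_sum
    by (subst amult_collapse_left[where \<phi> = "\<lambda>_. aq p x"]) (auto simp: H_mulb)
  then show "amult H (unit H) (bvec a) = bvec a"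
    by (simp add: H_mulb)
  have "amult H (bvec a) (unit H) = (\<Sum>j\<in>{a}. (1 * 1) *\<^sub>v mulb H j (p, \<one>))"
    unfolding H_unit a_sum
    by (subst amult_collapse_right[where \<phi> = "\<lambda>_. p"]) (auto simp: H_mulb)
  then show "amult H (bvec a) (unit H) = bvec a"
    by (simp add: H_mulb)
  fix b assume b: "b \<in> basis H"
  obtain q y where qy [simp]: "b = (q, y)" "q \<in> Q" "y \<in> F"
    using b by auto
  show "mulb H a b \<in> vecs (basis H)"
    by (auto simp: H_mulb zero_in_vecs intro!: scale_in_vecs bvec_in_vecs)
  fix c assume c: "c \<in> basis H"
  obtain r z where rz [simp]: "c = (r, z)" "r \<in> Q" "z \<in> F"
    using c by auto
  show "amult H (mulb H a b) (bvec c) = amult H (bvec a) (mulb H b c)"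
    \<comment> \<open>The elements of \<open>F\<close> multiply in the order \<open>z\<close>,
      \<open>y\<close>, \<open>x\<close>, starting from the rightmost factor, whence the arguments
      of the cocycle.\<close>
    using sigma_cocycle[of r z y x]
    by (auto simp: H_mulb amult_bvec act_Q_act_Q m_assoc mult_ac)
qed

section \<open>The normalized integral and its coproduct\<close>

definition Lambda :: "'g \<times> 'g \<Rightarrow> 'k" where
  "Lambda = (\<Sum>x\<in>F. inverse (of_nat (card F)) *\<^sub>v bvec (\<one>, x))"

lemma sum_F_mult_left:
  assumes "y \<in> F"
  shows "(\<Sum>x\<in>F. f (y \<otimes> x)) = (\<Sum>x\<in>F. f x)"
  using assms
  by (intro sum.reindex_bij_witness[where i = "\<lambda>x. inv y \<otimes> x" and j = "\<lambda>x. y \<otimes> x"])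
    (auto simp flip: m_assoc)

lemma sum_F_mult_right:
  assumes "y \<in> F"
  shows "(\<Sum>x\<in>F. f (x \<otimes> y)) = (\<Sum>x\<in>F. f x)"
  using assms
  by (intro sum.reindex_bij_witness[where i = "\<lambda>x. x \<otimes> inv y" and j = "\<lambda>x. x \<otimes> y"])
    (auto simp: m_assoc)

lemma Lambda_in_vecs: "Lambda \<in> vecs (Q \<times> F)"
  unfolding Lambda_def by (intro sum_in_vecs scale_in_vecs bvec_in_vecs) auto

text \<open>The identity of \<open>Q\<close> is fixed by \<open>F\<close> and carries no twist, so
  \<open>(\<one>, y)\<close> only permutes the summands by translation in \<open>F\<close>. Every
  other \<open>Q\<close>-component violates the matching condition.\<close>

lemma Lambda_absorbs:
  assumes "a \<in> Q \<times> F"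
  shows "amult H (bvec a) Lambda = counitb H a *\<^sub>v Lambda"
    and "amult H Lambda (bvec a) = counitb H a *\<^sub>v Lambda"
proof -
  obtain q y where a [simp]: "a = (q, y)" "q \<in> Q" "y \<in> F"
    using assms by auto
  have "amult H (bvec a) Lambda = (\<Sum>x\<in>F. inverse (of_nat (card F)) *\<^sub>v mulb H a (\<one>, x))"
    unfolding Lambda_def by (simp add: amult_sum_right amult_bvec)
  also have "\<dots> = counitb H a *\<^sub>v (\<Sum>x\<in>F. inverse (of_nat (card F)) *\<^sub>v bvec (\<one>, x \<otimes> y))"
    by (auto simp: H_mulb H_counitb)
  also have "(\<Sum>x\<in>F. inverse (of_nat (card F)) *\<^sub>v bvec (\<one>, x \<otimes> y)) = Lambda"
    unfolding Lambda_def by (rule sum_F_mult_right) simp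
  finally show "amult H (bvec a) Lambda = counitb H a *\<^sub>v Lambda" .
  have "amult H Lambda (bvec a) = (\<Sum>x\<in>F. inverse (of_nat (card F)) *\<^sub>v mulb H (\<one>, x) a)"
    unfolding Lambda_def by (simp add: amult_sum_left amult_bvec)
  also have "\<dots> = counitb H a *\<^sub>v (\<Sum>x\<in>F. inverse (of_nat (card F)) *\<^sub>v bvec (\<one>, y \<otimes> x))"
    by (auto simp: H_mulb H_counitb act_Q_eq_one_iff cocycle_F_left)
  also have "(\<Sum>x\<in>F. inverse (of_nat (card F)) *\<^sub>v bvec (\<one>, y \<otimes> x)) = Lambda"
    unfolding Lambda_def by (rule sum_F_mult_left) simp
  finally show "amult H Lambda (bvec a) = counitb H a *\<^sub>v Lambda" .
qed

lemma counit_Lambda: "counit H Lambda = 1"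
proof -
  \<comment> \<open>\<open>F\<close> contains the identity, so in characteristic zero its order is
    an invertible scalar.\<close>
  have "card F \<noteq> 0"
    using finite_F F_closed(3) by (metis card_0_eq empty_iff)
  have "Lambda (p, x) = (if p = \<one> \<and> x \<in> F then inverse (of_nat (card F)) else 0)" for p x
  proof -
    have "Lambda (p, x) = (\<Sum>y\<in>F. if y = x then (if p = \<one> then inverse (of_nat (card F)) else 0) else 0)"
      unfolding Lambda_def sum_fun_apply by (intro sum.cong) (auto simp: bvec_def)
    then show ?thesis
      by simp
  qed
  then have "counit H Lambda = (\<Sum>p\<in>Q. \<Sum>x\<in>F. if p = \<one> then inverse (of_nat (card F)) else 0)"
    unfolding counit_def by (auto simp: sum.cartesian_product' H_counitb intro!: sum.cong)
  also have "\<dots> = (\<Sum>p\<in>Q. if p = \<one> then of_nat (card F) * inverse (of_nat (card F)) else 0)"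
    by (intro sum.cong) auto
  also have "\<dots> = 1"
    using \<open>card F \<noteq> 0\<close> by simp
  finally show ?thesis .
qed

text \<open>Uniqueness follows by evaluating the product of \<open>Lambda\<close> with another
  normalized integral in two ways, letting either factor absorb the other.\<close>

lemma normalized_integral_H: "normalized_integral H = Lambda"
  unfolding normalized_integral_def
proof (rule the_equality)
  have "amult H h Lambda = counit H h *\<^sub>v Lambda \<and> amult H Lambda h = counit H h *\<^sub>v Lambda"
    if "h \<in> vecs (Q \<times> F)" for h
  proof -
    have "h = (\<Sum>b\<in>Q \<times> F. h b *\<^sub>v bvec b)"
      using that by (intro vecs_expand) auto
    moreover have "amult H (\<Sum>b\<in>Q \<times> F. h b *\<^sub>v bvec b) Lambda = counit H h *\<^sub>v Lambda"
      "amult H Lambda (\<Sum>b\<in>Q \<times> F. h b *\<^sub>v bvec b) = counit H h *\<^sub>v Lambda"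
      by (simp_all add: amult_sum_left amult_sum_right Lambda_absorbs counit_def scale_sum_left)
    ultimately show ?thesis
      by simp
  qed
  then show int: "is_normalized_integral H Lambda"
    unfolding is_normalized_integral_def using Lambda_in_vecs counit_Lambda by simp
  fix L assume L: "is_normalized_integral H L"
  have "L = counit H Lambda *\<^sub>v L"
    by (simp add: counit_Lambda)
  also have "\<dots> = amult H Lambda L"
    using L Lambda_in_vecs by (simp add: is_normalized_integral_def)
  also have "\<dots> = counit H L *\<^sub>v Lambda"
    using L int unfolding is_normalized_integral_def by blast
  also have "\<dots> = Lambda"
    using L by (simp add: is_normalized_integral_def)
  finally show "L = Lambda" .
qed

lemma comul_Lambda:
  "comul H Lambda = (\<Sum>(x, t)\<in>F \<times> Q.
    (inverse (of_nat (card F)) * \<omega> (Li t) t x) *\<^sub>v bvec ((Li t, af t x), (t, x)))"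
proof -
  have "comulb H (\<one>, x) = (\<Sum>t\<in>Q. \<omega> (Li t) t x *\<^sub>v bvec ((Li t, af t x), (t, x)))"
    if "x \<in> F" for x
  proof -
    have "{(s, t). s \<in> Q \<and> t \<in> Q \<and> dot G F Q s t = \<one>} = (\<lambda>t. (Li t, t)) ` Q"
      by (auto simp: dot_eq_one_iff image_iff L_inv_eqI)
    moreover have "inj_on (\<lambda>t. (Li t, t)) Q"
      by (auto simp: inj_on_def)
    ultimately show ?thesis
      by (simp add: quasi_hopf_A_op_def alg_A_def sum.reindex tau_def)
  qed
  moreover have "comul H Lambda = (\<Sum>x\<in>F. inverse (of_nat (card F)) *\<^sub>v comulb H (\<one>, x))"
    unfolding comul_def Lambda_def by (subst linext_sum_bvec) auto
  ultimately show ?thesis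
    by (simp add: sum.cartesian_product' scale_sum_right)
qed

section \<open>The antipode and its inverse on basis vectors\<close>

definition antipode_coeff :: "'g \<Rightarrow> 'g \<Rightarrow> 'k" where
  "antipode_coeff p x = inverse (\<omega> p (Ri p) (sc p x)) * inverse (\<omega> (Ri p) (sc p x) (inv (sc p x)))"

lemma antipode_coeff_nonzero [simp]: "p \<in> Q \<Longrightarrow> x \<in> F \<Longrightarrow> antipode_coeff p x \<noteq> 0"
  by (simp add: antipode_coeff_def)

lemma H_antipodeb: "antipodeb H (p, x) = antipode_coeff p x *\<^sub>v bvec (Ri (aq p x), inv (sc p x))"
  by (simp add: quasi_hopf_A_op_def antipode_coeff_def sigma_def tau_def)

lemma antipode_bvec:
  "p \<in> Q \<Longrightarrow> x \<in> F \<Longrightarrow> antipode H (bvec (p, x)) = antipode_coeff p x *\<^sub>v bvec (Ri (aq p x), inv (sc p x))"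
  unfolding antipode_def by (subst linext_bvec) (auto simp: H_antipodeb)

text \<open>The antipode permutes the basis labels up to nonzero scalars; \<open>?T\<close> undoes
  labels and scalars. Injectivity is what gives access to \<open>the_inv_into\<close> in
  \<open>antipode_inv\<close>.\<close>

lemma inj_antipode: "inj_on (antipode H) (vecs (Q \<times> F))"
proof (rule inj_on_inverseI)
  let ?T = "linext (Q \<times> F) (\<lambda>(a, v). inverse (antipode_coeff (Li (Qp (a \<otimes> v))) (inv (Fp (a \<otimes> v)))) *\<^sub>v
    bvec (Li (Qp (a \<otimes> v)), inv (Fp (a \<otimes> v))))"
  fix v :: "'g \<times> 'g \<Rightarrow> 'k"
  assume "v \<in> vecs (Q \<times> F)"
  then have v: "v = (\<Sum>b\<in>Q \<times> F. v b *\<^sub>v bvec b)"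
    by (intro vecs_expand) auto
  have "?T (antipode H (bvec (p, x))) = bvec (p, x)" if "p \<in> Q" "x \<in> F" for p x
    using that by (simp add: antipode_bvec linext_scale linext_bvec antipode_label fun_eq_iff)
  then have "?T (antipode H (\<Sum>b\<in>Q \<times> F. v b *\<^sub>v bvec b)) = (\<Sum>b\<in>Q \<times> F. v b *\<^sub>v bvec b)"
    by (auto simp: antipode_def linext_sum linext_scale intro!: sum.cong)
  then show "?T (antipode H v) = v"
    using v by simp
qed

text \<open>Carrying the scalar \<open>c\<close> in the statement avoids proving linearity of the
  inverse map: the right side is checked to be a preimage, and injectivity does the rest.\<close>

lemma antipode_inv_bvec:
  assumes "a \<in> Q" "v \<in> F"
  defines "p \<equiv> Li (Qp (a \<otimes> v))" and "x \<equiv> inv (Fp (a \<otimes> v))"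
  shows "antipode_inv H (c *\<^sub>v bvec (a, v)) = (c * inverse (antipode_coeff p x)) *\<^sub>v bvec (p, x)"
  unfolding antipode_inv_def
proof (rule the_inv_into_f_eq)
  note px = antipode_label_inverse[OF assms(1,2), folded p_def x_def]
  have "antipode H ((c * inverse (antipode_coeff p x)) *\<^sub>v bvec (p, x)) = (c * inverse (antipode_coeff p x)) *\<^sub>v antipode H (bvec (p, x))"
    by (simp add: antipode_def linext_scale)
  then show "antipode H ((c * inverse (antipode_coeff p x)) *\<^sub>v bvec (p, x)) = c *\<^sub>v bvec (a, v)"
    using px by (simp add: antipode_bvec mult.assoc)
  show "(c * inverse (antipode_coeff p x)) *\<^sub>v bvec (p, x) \<in> vecs (basis H)"
    using px by (auto intro!: scale_in_vecs bvec_in_vecs)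
qed (use inj_antipode in simp)


subsection \<open>The elements \<open>q\<^sub>L\<close> and \<open>p\<^sub>L\<close>\<close>

abbreviation "T3 \<equiv> tensor_alg H (tensor_alg H H)"

lemma mulb_T2: "mulb (tensor_alg H H) (a, b) (a', b') = tens (mulb H a a') (mulb H b b')"
  and basis_T2 [simp]: "basis (tensor_alg H H) = (Q \<times> F) \<times> (Q \<times> F)"
  by (simp_all add: tensor_alg_def)

lemma mulb_T3: "mulb T3 (a, b, c) (a', b', c') = tens (mulb H a a') (tens (mulb H b b') (mulb H c c'))"
  and basis_T3 [simp]: "basis T3 = (Q \<times> F) \<times> (Q \<times> F) \<times> (Q \<times> F)"
  by (simp_all add: tensor_alg_def)

lemma unit_T3: "unit T3 = (\<Sum>(p, q, r)\<in>Q \<times> Q \<times> Q. bvec ((p, \<one>), (q, \<one>), (r, \<one>)))"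
proof -
  have "unit T3 = tens (unit H) (tens (unit H) (unit H))"
    by (simp add: tensor_alg_def)
  then show ?thesis
    unfolding H_unit tens_sum_left by (simp add: tens_sum_right sum.cartesian_product')
qed

lemma associator_H:
  "associator H = (\<Sum>(p, q, r)\<in>Q \<times> Q \<times> Q. \<omega> p q r *\<^sub>v bvec ((p, th q r), (q, \<one>), (r, \<one>)))"
  by (simp add: quasi_hopf_A_op_def)

text \<open>Only the first tensor leg carries an element of \<open>F\<close>. Its inverse in the
  twisted algebra shifts \<open>p\<close> by the action of \<open>th q r\<close> and costs the
  scalar \<open>\<omega> p (th q r) (inv (th q r))\<close>.\<close>

lemma associator_inv_H:
  "associator_inv H = (\<Sum>(p, q, r)\<in>Q \<times> Q \<times> Q.
    inverse (\<omega> p q r * \<omega> p (th q r) (inv (th q r))) *\<^sub>v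
      bvec ((aq p (th q r), inv (th q r)), (q, \<one>), (r, \<one>)))" (is "_ = ?\<Psi>")
  unfolding associator_inv_def
proof (rule alg_inverse_eq)
  show "unital_assoc_alg T3"
    by (intro unital_assoc_alg_tensor unital_assoc_alg_H)
  show "associator H \<in> vecs (basis T3)"
    unfolding associator_H by (auto intro!: sum_in_vecs scale_in_vecs bvec_in_vecs)
  show "?\<Psi> \<in> vecs (basis T3)"
    by (auto intro!: sum_in_vecs scale_in_vecs bvec_in_vecs)
  have cancel: "u * (inverse u * inverse v) * v = 1" "inverse u * inverse v * u * v = 1"
    if "u \<noteq> 0" "v \<noteq> 0" for u v :: 'k
    using that by (simp_all add: field_simps)
  have "amult T3 (associator H) ?\<Psi> = (\<Sum>(p, q, r)\<in>Q \<times> Q \<times> Q. bvec ((aq p (th q r), \<one>), (q, \<one>), (r, \<one>)))"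
    unfolding associator_H split_def
    by (subst amult_collapse_left[where \<phi> = "\<lambda>i. i"])
      (auto simp: mulb_T3 H_mulb sigma_inv_commute cancel intro!: sum.cong)
  \<comment> \<open>For fixed \<open>q\<close> and \<open>r\<close>, acting by \<open>th q r\<close>
    permutes \<open>Q\<close>, so the shifted idempotents again sum to the unit.\<close>
  also have "\<dots> = unit T3"
    unfolding unit_T3
    by (rule sum.reindex_bij_witness
        [where i = "\<lambda>(p, q, r). (aq p (inv (th q r)), q, r)" and j = "\<lambda>(p, q, r). (aq p (th q r), q, r)"]) auto
  finally show "amult T3 (associator H) ?\<Psi> = unit T3" .
  show "amult T3 ?\<Psi> (associator H) = unit T3"
    unfolding associator_H unit_T3 split_def
    by (subst amult_collapse_left[where \<phi> = "\<lambda>i. i"])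
      (auto simp: mulb_T3 H_mulb act_Q_eq_iff cancel intro!: sum.cong)
qed

definition q_L_coeff :: "'g \<Rightarrow> 'g \<Rightarrow> 'k" where
  "q_L_coeff q r = inverse (\<omega> (Li q) q r * \<omega> (Li q) (th q r) (inv (th q r))) *
    antipode_coeff (aq (Li q) (th q r)) (inv (th q r))"

text \<open>The action of \<open>inv (th q r)\<close> undoes the shift in the inverse associator, so
  the antipode puts its first leg over \<open>Ri p\<close>. Multiplying by the second leg forces
  \<open>q = Ri p\<close>, that is \<open>p = Li q\<close>.\<close>

lemma q_L_H:
  "q_L H = (\<Sum>(q, r)\<in>Q \<times> Q. q_L_coeff q r *\<^sub>v
    bvec ((q, inv (sc (aq (Li q) (th q r)) (inv (th q r)))), (r, \<one>)))"
proof -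
  define X where "X p q r =
    (if q = Ri p then (inverse (\<omega> p q r * \<omega> p (th q r) (inv (th q r))) *
      antipode_coeff (aq p (th q r)) (inv (th q r))) *\<^sub>v
      bvec ((q, inv (sc (aq p (th q r)) (inv (th q r)))), (r, \<one>)) else 0)" for p q r
  have "amult H (amult H (antipode H (bvec (aq p (th q r), inv (th q r)))) (alpha H)) (bvec (q, \<one>))
    = (if q = Ri p then antipode_coeff (aq p (th q r)) (inv (th q r)) *\<^sub>v
        bvec (q, inv (sc (aq p (th q r)) (inv (th q r)))) else 0)"
    if "p \<in> Q" "q \<in> Q" "r \<in> Q" for p q r
    using that unital_assoc_alg_unit(2)[OF unital_assoc_alg_H bvec_in_vecs]
    by (auto simp: H_alpha antipode_bvec amult_bvec H_mulb)
  then have "q_L H = (\<Sum>(p, q, r)\<in>Q \<times> Q \<times> Q. X p q r)"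
    unfolding q_L_def associator_inv_H split_def
    by (subst linext_sum_bvec) (auto simp: X_def intro!: sum.cong)
  also have "\<dots> = (\<Sum>(q, r)\<in>Q \<times> Q. X (Li q) q r)"
    unfolding split_def by (subst sum_delta_fst[where \<phi> = "\<lambda>j. Li (fst j)"]) (auto simp: X_def)
  finally show ?thesis
    by (auto simp: X_def q_L_coeff_def intro!: sum.cong)
qed

text \<open>
  Only the summands of \<open>\<Phi>\<close> indexed by \<open>(q\<^sup>L, q, r)\<close> contribute to \<open>p\<^sub>L\<close>; \<open>p_L_label q r\<close> labels the
  basis vector \<open>\<S>\<^sup>-\<^sup>1(\<Phi>\<^sup>(\<^sup>1\<^sup>)\<beta>)\<close> in such a summand.
\<close>

definition p_L_coeff :: "'g \<Rightarrow> 'g \<Rightarrow> 'k" where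
  "p_L_coeff q r = (let v = inv (th q (Ri q)) \<otimes> th q r; p = Li (Qp (Ri q \<otimes> v)); x = inv (Fp (Ri q \<otimes> v)) in
    \<omega> (Li q) q r * \<omega> (inv (Ri q)) (Ri q) (inv (Ri q)) * \<omega> (Ri q) (inv (th q (Ri q))) (th q r) *
    inverse (antipode_coeff p x))"

definition p_L_label :: "'g \<Rightarrow> 'g \<Rightarrow> 'g \<times> 'g" where
  "p_L_label q r = (let v = inv (th q (Ri q)) \<otimes> th q r in
    (Li (Qp (Ri q \<otimes> v)), inv (Fp (Ri q \<otimes> v))))"

text \<open>The antipode carries this label to one over \<open>Ri q\<close>, whence the second
  claim. It is the matching condition for right multiplication by \<open>p_L\<close>.\<close>

lemma p_L_label_props:
  assumes "q \<in> Q" "r \<in> Q"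
  shows "p_L_label q r \<in> Q \<times> F" and "aq (fst (p_L_label q r)) (snd (p_L_label q r)) = q"
proof -
  have v: "inv (th q (Ri q)) \<otimes> th q r \<in> F"
    using assms by simp
  note * = antipode_label_inverse[OF R_inv(1)[OF assms(1)] v]
  show p_L_label: "p_L_label q r \<in> Q \<times> F"
    using * by (simp add: p_L_label_def Let_def)
  have "Li (Ri (aq (fst (p_L_label q r)) (snd (p_L_label q r)))) = Li (Ri q)"
    using * by (simp add: p_L_label_def Let_def)
  then show "aq (fst (p_L_label q r)) (snd (p_L_label q r)) = q"
    using p_L_label assms by (auto simp: mem_Times_iff)
qed

text \<open>The summand of \<open>beta\<close> at \<open>q\<close> matches \<open>p\<close> only if
  \<open>Li (Li q) = p\<close>, by \<open>act_Q_inv_theta\<close>; hence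
  \<open>q = Ri (Ri p)\<close>.\<close>

lemma amult_bvec_beta:
  assumes "p \<in> Q" "x \<in> F"
  defines "a \<equiv> Ri (Ri p)"
  shows "amult H (bvec (p, x)) (beta H)
    = (\<omega> (inv a) a (inv a) * \<omega> a (inv (th (Ri p) a)) x) *\<^sub>v bvec (a, inv (th (Ri p) a) \<otimes> x)"
proof -
  have beta: "beta H = (\<Sum>q\<in>Q. \<omega> (inv q) q (inv q) *\<^sub>v bvec (q, inv (th (Li q) q)))"
    by (simp add: quasi_hopf_A_op_def)
  have a: "a \<in> Q" "Li a = Ri p" and aq: "aq a (inv (th (Ri p) a)) = p"
    using assms act_Q_inv_theta[of a] by simp_all
  have single: "bvec (p, x) = (\<Sum>i\<in>{p}. (1::'k) *\<^sub>v bvec (i, x))"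
    by simp
  have "amult H (bvec (p, x)) (beta H) = (\<Sum>i\<in>{p}. (1 * \<omega> (inv a) a (inv a)) *\<^sub>v
      mulb H (i, x) (a, inv (th (Li a) a)))"
    unfolding beta single
    by (subst amult_collapse_right[where \<phi> = "\<lambda>_. a"])
      (use assms(1,2) in \<open>auto simp: a_def H_mulb act_Q_inv_theta\<close>)
  then show ?thesis
    using a aq by (simp add: H_mulb)
qed

lemma p_L_H: "p_L H = (\<Sum>(q, r)\<in>Q \<times> Q. p_L_coeff q r *\<^sub>v bvec (p_L_label q r, (r, \<one>)))"
proof -
  define X where "X p q r = (if p = Li q then p_L_coeff q r *\<^sub>v bvec (p_L_label q r, (r, \<one>)) else 0)" for p q r
  have "\<omega> p q r *\<^sub>v tens (amult H (bvec (q, \<one>)) (antipode_inv H (amult H (bvec (p, th q r)) (beta H)))) (bvec (r, \<one>))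
      = X p q r"
    if "p \<in> Q" "q \<in> Q" "r \<in> Q" for p q r
  proof -
    define a v where "a = Ri (Ri p)" and "v = inv (th (Ri p) a) \<otimes> th q r"
    define b w where "b = Li (Qp (a \<otimes> v))" and "w = inv (Fp (a \<otimes> v))"
    have av: "a \<in> Q" "v \<in> F"
      using that by (simp_all add: a_def v_def)
    note bw = antipode_label_inverse[OF av, folded b_def w_def]
    \<comment> \<open>Cancelling a right inverse shows that \<open>(b, w)\<close> matches
      \<open>(q, \<one>)\<close> exactly when \<open>q = Ri p\<close>, which leaves the triples with
      \<open>p = Li q\<close>.\<close>
    have "Li (Ri (aq b w)) = Li (Ri (Ri p))"
      unfolding bw(3) by (simp add: a_def)
    then have abw: "aq b w = Ri p"
      using bw(1,2) that by simp
    have "amult H (bvec (q, \<one>)) (antipode_inv H (amult H (bvec (p, th q r)) (beta H)))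
        = (\<omega> (inv a) a (inv a) * \<omega> a (inv (th (Ri p) a)) (th q r) * inverse (antipode_coeff b w)) *\<^sub>v
          (if q = Ri p then bvec (b, w) else 0)"
      using that av bw abw
      by (auto simp: amult_bvec_beta antipode_inv_bvec[OF av] amult_bvec H_mulb
          a_def[symmetric] v_def[symmetric] b_def[symmetric] w_def[symmetric])
    then show ?thesis
      using that
      by (auto simp: X_def p_L_coeff_def p_L_label_def Let_def a_def v_def b_def w_def mult_ac)
  qed
  then have "p_L H = (\<Sum>(p, q, r)\<in>Q \<times> Q \<times> Q. X p q r)"
    unfolding p_L_def associator_H split_def
    by (subst linext_sum_bvec) (auto intro!: sum.cong)
  also have "\<dots> = (\<Sum>(q, r)\<in>Q \<times> Q. X (Li q) q r)"
    unfolding split_def by (subst sum_delta_fst[where \<phi> = "\<lambda>j. Li (fst j)"]) (auto simp: X_def)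
  finally show ?thesis
    by (auto simp: X_def intro!: sum.cong)
qed


subsection \<open>The canonical central element\<close>

definition q_L_comul_coeff :: "'g \<Rightarrow> 'g \<Rightarrow> 'k" where
  "q_L_comul_coeff x t = q_L_coeff (Li (aq t x)) (aq t x) * (inverse (of_nat (card F)) * \<omega> (Li t) t x) *
    \<omega> (Li t) (af t x) (aq t x \<otimes> Ri (aq t x))"

text \<open>The second tensor legs force \<open>r = aq t x\<close>, and the first legs then force
  \<open>q = Li (aq t x)\<close> by \<open>act_Q_L_inv\<close>. For these indices
  \<open>succ_inv_theta\<close> turns the label of \<open>q_L\<close> into
  \<open>r \<otimes> Ri r\<close>.\<close>

lemma q_L_comul_Lambda:
  "amult (tensor_alg H H) (q_L H) (comul H Lambda)
    = (\<Sum>(x, t)\<in>F \<times> Q. q_L_comul_coeff x t *\<^sub>v bvec ((Li t, af t x \<otimes> (aq t x \<otimes> Ri (aq t x))), (t, x)))"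
proof -
  have "amult (tensor_alg H H) (q_L H) (comul H Lambda)
    = (\<Sum>(x, t)\<in>F \<times> Q. (q_L_coeff (Li (aq t x)) (aq t x) * (inverse (of_nat (card F)) * \<omega> (Li t) t x)) *\<^sub>v
        mulb (tensor_alg H H) ((Li (aq t x), aq t x \<otimes> Ri (aq t x)), (aq t x, \<one>)) ((Li t, af t x), (t, x)))"
    unfolding q_L_H comul_Lambda split_def
    by (subst amult_collapse_left[where \<phi> = "\<lambda>i. (Li (aq (snd i) (fst i)), aq (snd i) (fst i))"])
      (auto simp: mulb_T2 H_mulb act_Q_L_inv act_Q_L_inv_L_inv succ_inv_theta intro!: sum.cong)
  also have "\<dots> = (\<Sum>(x, t)\<in>F \<times> Q. q_L_comul_coeff x t *\<^sub>v bvec ((Li t, af t x \<otimes> (aq t x \<otimes> Ri (aq t x))), (t, x)))"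
    by (auto simp: mulb_T2 H_mulb act_Q_L_inv q_L_comul_coeff_def intro!: sum.cong)
  finally show ?thesis .
qed

text \<open>Here \<open>Ri (Li t) = t\<close>, so the two values of \<open>theta\<close> in the
  label cancel. Right multiplication by \<open>p_L\<close> therefore only rescales the surviving
  basis vectors.\<close>

lemma p_L_label_L_inv: "t \<in> Q \<Longrightarrow> p_L_label (Li t) t = (Li t, \<one>)"
  by (simp add: p_L_label_def)

lemma q_L_comul_Lambda_p_L:
  "amult (tensor_alg H H) (amult (tensor_alg H H) (q_L H) (comul H Lambda)) (p_L H)
    = (\<Sum>(x, t)\<in>F \<times> Q. (q_L_comul_coeff x t * p_L_coeff (Li t) t) *\<^sub>v
        bvec ((Li t, af t x \<otimes> (aq t x \<otimes> Ri (aq t x))), (t, x)))"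
proof -
  have *: "mulb H (p, v) (p_L_label q r) = (if q = p then \<omega> (fst (p_L_label q r)) (snd (p_L_label q r)) v *\<^sub>v
      bvec (fst (p_L_label q r), snd (p_L_label q r) \<otimes> v) else 0)"
    if "q \<in> Q" "r \<in> Q" for p q r v
    using H_mulb[of p v "fst (p_L_label q r)" "snd (p_L_label q r)"] p_L_label_props(2)[OF that] by simp
  show ?thesis
    unfolding q_L_comul_Lambda p_L_H split_def
    using p_L_label_props(1)
    by (subst amult_collapse_right[where \<phi> = "\<lambda>i. (Li (snd i), snd i)"])
      (auto simp: * mem_Times_iff mulb_T2 H_mulb p_L_label_L_inv intro!: sum.cong)
qed

lemma dot_act_Q_eq_one_iff:
  "t \<in> Q \<Longrightarrow> x \<in> F \<Longrightarrow> dot G F Q (aq t x) t = \<one> \<longleftrightarrow> aq t x = Li t"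
  using L_inv_eqI[of t "aq t x"] by (auto simp: dot_eq_one_iff)

text \<open>The last multiplication requires \<open>aq t x = Li t\<close>, which is the index
  condition of the sum. Then \<open>Ri (aq t x) = t\<close>, and regrouping the label gives the
  square of \<open>x \<otimes> t\<close>.\<close>

lemma canonical_central_sum:
  "canonical_central H = (\<Sum>(q, x)\<in>{(q, x). q \<in> Q \<and> x \<in> F \<and> dot G F Q (aq q x) q = \<one>}.
    (q_L_comul_coeff x q * p_L_coeff (Li q) q * \<omega> q x (af q x \<otimes> (Li q \<otimes> q))) *\<^sub>v bvec (q, (x \<otimes> q) [^] (2::nat)))"
proof -
  have label: "x \<otimes> (af t x \<otimes> (Li t \<otimes> t)) = (x \<otimes> t) [^] (2::nat)"
    if "t \<in> Q" "x \<in> F" "aq t x = Li t" for t x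
  proof -
    have "x \<otimes> (af t x \<otimes> (Li t \<otimes> t)) = x \<otimes> ((af t x \<otimes> aq t x) \<otimes> t)"
      using that by (simp add: m_assoc)
    also have "\<dots> = (x \<otimes> t) \<otimes> (x \<otimes> t)"
      using that(1,2) by (simp add: act_mult m_assoc)
    finally show ?thesis
      using that by (simp add: numeral_2_eq_2)
  qed
  let ?c = "\<lambda>t x. (q_L_comul_coeff x t * p_L_coeff (Li t) t * \<omega> t x (af t x \<otimes> (Li t \<otimes> t))) *\<^sub>v bvec (t, (x \<otimes> t) [^] (2::nat))"
  have "canonical_central H = (\<Sum>(x, t)\<in>F \<times> Q. (q_L_comul_coeff x t * p_L_coeff (Li t) t) *\<^sub>v
      mulb H (Li t, af t x \<otimes> (aq t x \<otimes> Ri (aq t x))) (t, x))"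
    unfolding canonical_central_def normalized_integral_H q_L_comul_Lambda_p_L split_def
    by (subst linext_sum_bvec) auto
  also have "\<dots> = (\<Sum>(x, t)\<in>F \<times> Q. if dot G F Q (aq t x) t = \<one> then ?c t x else 0)"
    by (auto simp: H_mulb dot_act_Q_eq_one_iff label intro!: sum.cong)
  also have "\<dots> = (\<Sum>(t, x)\<in>Q \<times> F. if dot G F Q (aq t x) t = \<one> then ?c t x else 0)"
    by (rule sum.reindex_bij_witness[where i = "\<lambda>(x, t). (t, x)" and j = "\<lambda>(x, t). (t, x)"]) auto
  also have "\<dots> = (\<Sum>(t, x)\<in>{(t, x). t \<in> Q \<and> x \<in> F \<and> dot G F Q (aq t x) t = \<one>}. ?c t x)"
    by (intro sum.mono_neutral_cong_right) auto
  finally show ?thesis .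
qed

text \<open>The coefficients of \<open>q_L\<close> and \<open>p_L\<close> multiply to
  \<open>\<omega> (Li s) s t\<close>; the rest comes from the coproduct of \<open>Lambda\<close> and
  from the two multiplications.\<close>

lemma canonical_coefficient:
  assumes "t \<in> Q" "x \<in> F" and tx: "aq t x = Li t"
  defines "s \<equiv> Li t" and "y \<equiv> af t x"
  shows "q_L_comul_coeff x t * p_L_coeff s t * \<omega> t x (y \<otimes> (s \<otimes> t)) = inverse (of_nat (card F)) *
    (\<omega> s t x * \<omega> (Li s) s t * (\<omega> s y (s \<otimes> t) * \<omega> t x (y \<otimes> (s \<otimes> t))))"
proof -
  define g where "g = Li s \<otimes> s"
  have s: "s \<in> Q" "Ri s = t" "s \<otimes> t \<in> F" and g: "g \<in> F" "th (Li s) s = g" "th s t = s \<otimes> t"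
    using assms by (simp_all add: g_def s_def theta_eq_mult)
  have "aq (Li (Li s)) g = s"
    using act_Q_L_inv_L_inv[of s] s g by simp
  moreover have "sc s (inv g) = inv (s \<otimes> t)"
    using succ_inv_theta[of s] s g by simp
  ultimately have q_L_coeff: "q_L_coeff (Li s) s = inverse (\<omega> (Li (Li s)) (Li s) s * \<omega> (Li (Li s)) g (inv g)) *
      (inverse (\<omega> s t (inv (s \<otimes> t))) * inverse (\<omega> t (inv (s \<otimes> t)) (s \<otimes> t)))"
    using s g by (simp add: q_L_coeff_def antipode_coeff_def)
  \<comment> \<open>The inverse antipode is applied at the label \<open>(s, \<one>)\<close>, so it
    contributes no scalar.\<close>
  have "sc s \<one> = \<one>"
    using s assms(1) by (simp add: succ_eq)
  then have "antipode_coeff s \<one> = 1"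
    using s assms(1) by (simp add: antipode_coeff_def)
  then have p_L_coeff: "p_L_coeff s t = \<omega> (Li s) s t * \<omega> (inv t) t (inv t) * \<omega> t (inv (s \<otimes> t)) (s \<otimes> t)"
    using s g assms(1) by (simp add: p_L_coeff_def Let_def s_def[symmetric])
  have q_L_comul_coeff: "q_L_comul_coeff x t = q_L_coeff (Li s) s * (inverse (of_nat (card F)) * \<omega> s t x) * \<omega> s y (s \<otimes> t)"
    using s by (simp add: q_L_comul_coeff_def tx s_def[symmetric] y_def)
  have nz: "\<omega> (Li (Li s)) (Li s) s \<noteq> 0" "\<omega> (Li (Li s)) g (inv g) \<noteq> 0"
    "\<omega> s t (inv (s \<otimes> t)) \<noteq> 0" "\<omega> t (inv (s \<otimes> t)) (s \<otimes> t) \<noteq> 0"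
    using s g assms(1) by simp_all
  \<comment> \<open>\<open>cocycle_inv_eq\<close> expands the scalar of \<open>beta\<close> into the
    factors \<open>A\<close>, \<open>B\<close>, \<open>C\<close> inverted in \<open>q_L\<close>; the
    twist from multiplying by \<open>beta\<close> is \<open>D\<close>, inverted in the antipode
    coefficient.\<close>
  have "q_L_coeff (Li s) s * p_L_coeff s t = \<omega> (Li s) s t"
  proof -
    have "inverse (A * B) * (inverse C * inverse D) * (E * (A * B * C) * D) = E"
      if "A \<noteq> 0" "B \<noteq> 0" "C \<noteq> 0" "D \<noteq> 0" for A B C D E :: 'k
      using that by (simp add: field_simps)
    then show ?thesis
      unfolding q_L_coeff p_L_coeff cocycle_inv_eq[OF assms(1), folded s_def, folded g_def] using nz by blast
  qed
  moreover have "q_L_comul_coeff x t * p_L_coeff s t * \<omega> t x (y \<otimes> (s \<otimes> t)) = inverse (of_nat (card F)) *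
      (\<omega> s t x * (q_L_coeff (Li s) s * p_L_coeff s t) * (\<omega> s y (s \<otimes> t) * \<omega> t x (y \<otimes> (s \<otimes> t))))"
    unfolding q_L_comul_coeff by (simp only: mult_ac)
  ultimately show ?thesis
    by simp
qed

end

theorem theorem5p2:
  fixes G :: "('g, 'm) monoid_scheme" (structure)
    and F Q :: "'g set"
    and \<omega> :: "'g \<Rightarrow> 'g \<Rightarrow> 'g \<Rightarrow> 'k::{alg_closed_field, field_char_0}"
  assumes "group G" and "finite (carrier G)"
    and "subgroup F G"
    and "Q \<subseteq> carrier G" and "\<one> \<in> Q"
    and "\<And>g. g \<in> carrier G \<Longrightarrow> \<exists>!q. q \<in> Q \<and> q \<in> F #> g"
    and "\<And>g. g \<in> carrier G \<Longrightarrow> \<exists>!q. q \<in> Q \<and> q \<in> g <# F"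
    and "normalized_3_cocycle G \<omega>"
    and "\<And>x g h. x \<in> F \<Longrightarrow> g \<in> carrier G \<Longrightarrow> h \<in> carrier G \<Longrightarrow> \<omega> x g h = 1"
    and "\<And>g x q. g \<in> carrier G \<Longrightarrow> x \<in> F \<Longrightarrow> q \<in> Q \<Longrightarrow> \<omega> g x q = 1"
  shows
    "canonical_central (quasi_hopf_A_op G F Q \<omega>) =
      inverse (of_nat (card F)) *\<^sub>v
      (\<Sum>(q, x)\<in>{(q, x). q \<in> Q \<and> x \<in> F \<and> dot G F Q (act_Q G F Q q x) q = \<one>}.
        \<omega> (x \<otimes> q) (x \<otimes> q) (x \<otimes> q) *\<^sub>v bvec (q, (x \<otimes> q) [^] (2::nat))) \<and>
     canonical_central (quasi_hopf_A_op G F Q \<omega>) =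
      inverse (of_nat (card F)) *\<^sub>v
      (\<Sum>(q, x)\<in>{(q, x). q \<in> Q \<and> x \<in> F \<and> dot G F Q (act_Q G F Q q x) q = \<one>}.
        (tau \<omega> x (act_Q G F Q q x) q *
         sigma \<omega> q x (act_F G F Q q x) *
         \<omega> (L_inv G F Q (act_Q G F Q q x)) (act_Q G F Q q x) q *
         sigma \<omega> q (x \<otimes> act_F G F Q q x) (act_Q G F Q q x \<otimes> q)) *\<^sub>v
        bvec (q, (x \<otimes> q) [^] (2::nat)))"
proof -
  interpret transversal_cocycle G F Q \<omega>
    by (intro transversal_cocycle.intro transversal.intro transversal_axioms.intro
        transversal_cocycle_axioms.intro assms)
  let ?S = "{(q, x). q \<in> Q \<and> x \<in> F \<and> dot G F Q (aq q x) q = \<one>}"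
  have act: "q \<in> Q" "x \<in> F" "aq q x = Li q" if "(q, x) \<in> ?S" for q x
    using that by (auto simp: dot_act_Q_eq_one_iff)
  have "q_L_comul_coeff x q * p_L_coeff (Li q) q * \<omega> q x (af q x \<otimes> (Li q \<otimes> q))
      = inverse (of_nat (card F)) * \<omega> (x \<otimes> q) (x \<otimes> q) (x \<otimes> q)" if "(q, x) \<in> ?S" for q x
    using canonical_coefficient[OF act[OF that]] cocycle_act_eq(2)[OF act[OF that]] by simp
  then have "canonical_central H = inverse (of_nat (card F)) *\<^sub>v
      (\<Sum>(q, x)\<in>?S. \<omega> (x \<otimes> q) (x \<otimes> q) (x \<otimes> q) *\<^sub>v bvec (q, (x \<otimes> q) [^] (2::nat)))"
    unfolding canonical_central_sum scale_sum_right by (intro sum.cong) auto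
  \<comment> \<open>The second form follows by inserting the first equation of
    \<open>cocycle_act_eq\<close> into the second and replacing \<open>Li q\<close> by
    \<open>aq q x\<close>.\<close>
  moreover have "\<omega> (x \<otimes> q) (x \<otimes> q) (x \<otimes> q) = tau \<omega> x (aq q x) q * sigma \<omega> q x (af q x) *
      \<omega> (Li (aq q x)) (aq q x) q * sigma \<omega> q (x \<otimes> af q x) (aq q x \<otimes> q)" if "(q, x) \<in> ?S" for q x
    using cocycle_act_eq[OF act[OF that]] by (simp add: act[OF that] tau_def sigma_def)
  then have "(\<Sum>(q, x)\<in>?S. \<omega> (x \<otimes> q) (x \<otimes> q) (x \<otimes> q) *\<^sub>v bvec (q, (x \<otimes> q) [^] (2::nat)))
      = (\<Sum>(q, x)\<in>?S. (tau \<omega> x (aq q x) q * sigma \<omega> q x (af q x) * \<omega> (Li (aq q x)) (aq q x) q *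
          sigma \<omega> q (x \<otimes> af q x) (aq q x \<otimes> q)) *\<^sub>v bvec (q, (x \<otimes> q) [^] (2::nat)))"
    by (intro sum.cong) auto
  ultimately show ?thesis
    by simp
qed

end
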